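(* Let $d\ge 1$ and let $G$ be a graph with $n\ge d+2$ vertices. The set of Gstressable frameworks of $G$ in $\mathbb{R}^d$, viewed as a subset of the configuration space $(\mathbb{R}^d)^n=\mathbb{R}^{dn}$, is a real irreducible constructible set.
   Context: Graphs are finite and simple, with vertex set $\{1,\dots,n\}$. A framework $(G,p)$ in $\mathbb{R}^d$ is the graph $G$ with a configuration $p=(p_1,\dots,p_n)$ of points of $\mathbb{R}^d$. The configuration $p$ is in affine general position if no $k\le d+1$ of its points lie on a $(k-2)$-dimensional affine subspace. An equilibrium stress matrix of $(G,p)$ is a real symmetric $n\times n$ matrix $\Omega$ with $\Omega_{ij}=0$ whenever $i\neq j$ and $\{i,j\}$ is not an edge, with the all-ones vector in its kernel, and with $\sum_j\Omega_{ij}p_j=0$ for all $i$. The framework $(G,p)$ is Gstressable if $p$ is in affine general position and $(G,p)$ has an equilibrium stress matrix of rank $n-d-1$. Algebraic sets in $\mathbb{R}^N$ are common zero sets of finitely many polynomials; a quasi-projective variety is an algebraic set minus an algebraic set; a constructible set is a finite union of quasi-projective varieties. An algebraic set is irreducible if it is not the union of two proper algebraic subsets (with this convention the empty set, which may occur here, is irreducible); a constructible set is irreducible if its Zariski closure is. *)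

theory Defs
  imports "HOL-Analysis.Analysis"
begin

section \<open>Algebraic, constructible and irreducible sets\<close>

text \<open>\<^const>\<open>real_polynomial_function\<close> is the class of functions generated from the bounded linear
  functionals and the constants by sums and products; on a Euclidean space these are exactly the
  polynomials in the coordinates.\<close>

definition algebraic_set :: "'a::euclidean_space set \<Rightarrow> bool" where
  "algebraic_set X \<longleftrightarrow>
     (\<exists>F. finite F \<and> (\<forall>f\<in>F. real_polynomial_function f) \<and> X = {x. \<forall>f\<in>F. f x = 0})"

definition quasi_projective :: "'a::euclidean_space set \<Rightarrow> bool" where
  "quasi_projective X \<longleftrightarrow> (\<exists>A B. algebraic_set A \<and> algebraic_set B \<and> X = A - B)"

definition constructible :: "'a::euclidean_space set \<Rightarrow> bool" where
  "constructible X \<longleftrightarrow> (\<exists>Q. finite Q \<and> (\<forall>Y\<in>Q. quasi_projective Y) \<and> X = \<Union>Q)"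

definition zariski_closure :: "'a::euclidean_space set \<Rightarrow> 'a set" where
  "zariski_closure X = \<Inter>{A. algebraic_set A \<and> X \<subseteq> A}"

text \<open>The empty set counts as irreducible.\<close>

definition irreducible_algebraic_set :: "'a::euclidean_space set \<Rightarrow> bool" where
  "irreducible_algebraic_set X \<longleftrightarrow>
     algebraic_set X \<and>
     \<not> (\<exists>A B. algebraic_set A \<and> algebraic_set B \<and> A \<subset> X \<and> B \<subset> X \<and> X = A \<union> B)"

definition irreducible_constructible_set :: "'a::euclidean_space set \<Rightarrow> bool" where
  "irreducible_constructible_set X \<longleftrightarrow>
     constructible X \<and> irreducible_algebraic_set (zariski_closure X)"


section \<open>Frameworks and stress matrices\<close>

text \<open>The vertex set is the finite type \<open>'n\<close>, so that \<open>n = CARD('n)\<close>, and \<open>d = CARD('d)\<close>.  A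
  configuration is a vector \<open>p :: real^'d^'n\<close> whose \<open>i\<close>-th entry \<open>p $ i\<close> is the point of the
  vertex \<open>i\<close>.  A graph is given by its set of edges.\<close>

definition simple_graph :: "'n set set \<Rightarrow> bool" where
  "simple_graph E \<longleftrightarrow> (\<forall>e\<in>E. card e = 2)"

text \<open>The points are counted by their indices in \<open>S\<close>, so coinciding points violate the condition
  (take \<open>k = 2\<close>).  For \<open>k = 1\<close> the only subspace of dimension \<open>-1\<close> is the empty one, and for \<open>k = 0\<close>
  there is none.\<close>

definition affine_general_position :: "real^'d^'n \<Rightarrow> bool" where
  "affine_general_position p \<longleftrightarrow>
     \<not> (\<exists>S A. card S \<le> CARD('d) + 1 \<and> affine A \<and> aff_dim A = int (card S) - 2 \<and>
             (\<forall>i\<in>S. p $ i \<in> A))"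

text \<open>The vector \<open>1\<close> is the all-ones vector.\<close>

definition equilibrium_stress_matrix :: "'n set set \<Rightarrow> real^'d^'n \<Rightarrow> real^'n^'n \<Rightarrow> bool" where
  "equilibrium_stress_matrix E p \<Omega> \<longleftrightarrow>
     transpose \<Omega> = \<Omega> \<and>
     (\<forall>i j. i \<noteq> j \<and> {i, j} \<notin> E \<longrightarrow> \<Omega> $ i $ j = 0) \<and>
     \<Omega> *v 1 = 0 \<and>
     (\<forall>i. (\<Sum>j\<in>UNIV. (\<Omega> $ i $ j) *\<^sub>R (p $ j)) = 0)"

text \<open>The rank condition \<open>rank \<Omega> = n - d - 1\<close> is written without truncated subtraction.\<close>

definition Gstressable :: "'n set set \<Rightarrow> real^'d^'n \<Rightarrow> bool" where
  "Gstressable E p \<longleftrightarrow>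
     affine_general_position p \<and>
     (\<exists>\<Omega>. equilibrium_stress_matrix E p \<Omega> \<and> rank \<Omega> + CARD('d) + 1 = CARD('n))"

end

theory Submission
  imports Defs "HOL-Library.Function_Algebras"
begin

text \<open>Irreducibility: any two Gstressable configurations are joined by a rational curve all but
  finitely many of whose points are Gstressable, so a product of two polynomials that vanishes on the
  set cannot have both factors nonzero somewhere on it.  To build the curve, fix a set \<open>C\<close> of \<open>d + 1\<close>
  vertices.  A stress matrix \<open>\<Omega>\<close> of rank \<open>n - d - 1\<close> is \<open>V\<^sup>T J V\<close>, where \<open>J\<close> is the nonsingular block of
  \<open>\<Omega>\<close> outside \<open>C\<close> and the columns of \<open>V\<close> outside \<open>C\<close> are unit vectors; the graph condition says that
  nonadjacent columns are \<open>J\<close>-orthogonal.  As in the work of Lov'asz, Saks and Schrijver on orthogonal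
  representations, one interpolates \<open>J\<close> linearly and then moves the remaining columns one at a time:
  general position makes the previous constraints on each column linearly independent at both ends of
  the curve, so the solution is a polynomial projection of a linearly moving vector.  The
  configuration is recovered as the kernel of \<open>V\<close>, which is explicit, followed by dehomogenization.

  Constructibility: for fixed \<open>p\<close> the stresses form a linear space.  On the stratum where a given
  sublist of the equations is a maximal independent one, that space has a polynomial parametrization,
  and the nonvanishing of a minor at some parameter is an open condition.  Hilbert's basis theorem
  makes infinite systems of polynomial equations, among them those of a Zariski closure, finite.\<close>

section \<open>Hilbert's basis theorem and Zariski closures\<close>

text \<open>Rings are subsets of one fixed commutative ring. Coordinates can thus be adjoined one
  after another inside the ring of real functions with pointwise operations, without a change of
  type.\<close>

definition subring :: "'r::comm_ring_1 set \<Rightarrow> bool" where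
  "subring A \<longleftrightarrow> 0 \<in> A \<and> 1 \<in> A \<and> (\<forall>x\<in>A. - x \<in> A) \<and> (\<forall>x\<in>A. \<forall>y\<in>A. x + y \<in> A \<and> x * y \<in> A)"

inductive_set ideal_gen :: "'r::comm_ring_1 set \<Rightarrow> 'r set \<Rightarrow> 'r set"
  for A G where
    zero: "0 \<in> ideal_gen A G"
  | step: "a \<in> A \<Longrightarrow> g \<in> G \<Longrightarrow> x \<in> ideal_gen A G \<Longrightarrow> a * g + x \<in> ideal_gen A G"

text \<open>The generators come from \<open>F\<close> itself, so a family of polynomials will yield
  a finite subfamily with the same zeros.\<close>

definition noetherian :: "'r::comm_ring_1 set \<Rightarrow> bool" where
  "noetherian A \<longleftrightarrow> (\<forall>F\<subseteq>A. \<exists>G\<subseteq>F. finite G \<and> F \<subseteq> ideal_gen A G)"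

text \<open>The values at \<open>t\<close> of the polynomials over \<open>A\<close> of degree less
  than \<open>n\<close>. Since \<open>t\<close> may satisfy algebraic relations over
  \<open>A\<close>, neither the coefficients nor the degree of an element need be unique.\<close>

primrec poly_below :: "'r::comm_ring_1 set \<Rightarrow> 'r \<Rightarrow> nat \<Rightarrow> 'r set" where
  "poly_below A t 0 = {0}"
| "poly_below A t (Suc n) = {x + c * t ^ n |x c. x \<in> poly_below A t n \<and> c \<in> A}"

definition adjoin :: "'r::comm_ring_1 set \<Rightarrow> 'r \<Rightarrow> 'r set" where
  "adjoin A t = (\<Union>n. poly_below A t n)"

lemma ideal_gen_mono: "x \<in> ideal_gen A G \<Longrightarrow> G \<subseteq> H \<Longrightarrow> x \<in> ideal_gen A H"
proof (induction rule: ideal_gen.induct)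
  case (step a g x)
  then show ?case by (intro ideal_gen.step) blast+
qed (rule ideal_gen.zero)

lemma ideal_gen_add:
  "x \<in> ideal_gen A G \<Longrightarrow> y \<in> ideal_gen A G \<Longrightarrow> x + y \<in> ideal_gen A G"
  by (induction rule: ideal_gen.induct) (auto simp: add.assoc intro: ideal_gen.intros)

lemma ideal_gen_mult:
  assumes "subring A" "x \<in> ideal_gen A G" "a \<in> A"
  shows "a * x \<in> ideal_gen A G"
  using assms(2)
proof induction
  case zero
  then show ?case by (simp add: ideal_gen.zero)
next
  case (step b g x)
  have "(a * b) * g + a * x \<in> ideal_gen A G"
    using step assms by (intro ideal_gen.step) (auto simp: subring_def)
  then show ?case by (simp add: algebra_simps)
qed

lemma ideal_gen_diff:
  assumes "subring A" "x \<in> ideal_gen A G" "y \<in> ideal_gen A G"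
  shows "x - y \<in> ideal_gen A G"
proof -
  have "(- 1) * y \<in> ideal_gen A G"
    using assms by (intro ideal_gen_mult) (auto simp: subring_def)
  with assms(2) have "x + (- 1) * y \<in> ideal_gen A G"
    by (rule ideal_gen_add)
  then show ?thesis by simp
qed

lemma ideal_gen_superset:
  assumes "subring A" shows "G \<subseteq> ideal_gen A G"
proof
  fix g assume "g \<in> G"
  then have "1 * g + 0 \<in> ideal_gen A G"
    using assms by (intro ideal_gen.intros) (auto simp: subring_def)
  then show "g \<in> ideal_gen A G" by simp
qed

lemma ideal_gen_trans:
  assumes "subring A" "x \<in> ideal_gen A G" "G \<subseteq> ideal_gen A H"
  shows "x \<in> ideal_gen A H"
  using assms(2)
proof induction
  case (step a g x)
  then show ?case using assms by (intro ideal_gen_add ideal_gen_mult) blast+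
qed (rule ideal_gen.zero)

lemma ideal_gen_subset:
  assumes "subring A" "G \<subseteq> A"
  shows "ideal_gen A G \<subseteq> A"
proof
  fix x assume "x \<in> ideal_gen A G"
  then show "x \<in> A" by induction (use assms in \<open>auto simp: subring_def\<close>)
qed

lemma ideal_gen_finite:
  assumes "x \<in> ideal_gen A F"
  obtains G where "finite G" "G \<subseteq> F" "x \<in> ideal_gen A G"
proof -
  have "\<exists>G. finite G \<and> G \<subseteq> F \<and> x \<in> ideal_gen A G"
    using assms
  proof induction
    case zero
    then show ?case by (auto intro: ideal_gen.zero)
  next
    case (step a g x)
    then obtain G where "finite G" "G \<subseteq> F" "x \<in> ideal_gen A G" by auto
    with step.hyps show ?case
      by (intro exI[of _ "insert g G"]) (auto intro: ideal_gen.step ideal_gen_mono)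
  qed
  then show ?thesis using that by auto
qed

lemma ideal_gen_finite_set:
  assumes "finite X" "X \<subseteq> ideal_gen A F"
  obtains G where "finite G" "G \<subseteq> F" "X \<subseteq> ideal_gen A G"
proof -
  have "\<forall>x\<in>X. \<exists>G. finite G \<and> G \<subseteq> F \<and> x \<in> ideal_gen A G"
    using assms(2) ideal_gen_finite by (metis subsetD)
  then obtain f where f: "\<And>x. x \<in> X \<Longrightarrow> finite (f x) \<and> f x \<subseteq> F \<and> x \<in> ideal_gen A (f x)"
    by metis
  show ?thesis
  proof (rule that[of "\<Union> (f ` X)"])
    show "X \<subseteq> ideal_gen A (\<Union> (f ` X))"
      using f by (meson UN_upper ideal_gen_mono subsetI)
  qed (use f assms(1) in auto)
qed

section \<open>Adjoining one element to a ring\<close>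

lemma poly_below_zero: "subring A \<Longrightarrow> 0 \<in> poly_below A t n"
proof (induction n)
  case (Suc n)
  then have "0 = 0 + 0 * t ^ n" "0 \<in> poly_below A t n" "0 \<in> A"
    by (auto simp: subring_def)
  then show ?case unfolding poly_below.simps by blast
qed simp

lemma poly_below_Suc: "subring A \<Longrightarrow> x \<in> poly_below A t n \<Longrightarrow> x \<in> poly_below A t (Suc n)"
proof -
  assume "subring A" "x \<in> poly_below A t n"
  then have "x = x + 0 * t ^ n" "x \<in> poly_below A t n" "0 \<in> A"
    by (auto simp: subring_def)
  then show ?thesis unfolding poly_below.simps by blast
qed

lemma poly_below_mono:
  assumes "subring A" "m \<le> n" "x \<in> poly_below A t m" shows "x \<in> poly_below A t n"
  using assms(2) by (induction rule: dec_induct) (use assms poly_below_Suc in auto)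

lemma poly_below_add:
  assumes "subring A"
  shows "x \<in> poly_below A t n \<Longrightarrow> y \<in> poly_below A t n \<Longrightarrow> x + y \<in> poly_below A t n"
proof (induction n arbitrary: x y)
  case (Suc n)
  then obtain x' c y' d where *: "x = x' + c * t ^ n" "y = y' + d * t ^ n" "c \<in> A" "d \<in> A"
    "x' \<in> poly_below A t n" "y' \<in> poly_below A t n" by auto
  then have "x + y = (x' + y') + (c + d) * t ^ n" "c + d \<in> A"
    using assms by (auto simp: algebra_simps subring_def)
  with * Suc.IH show ?case unfolding poly_below.simps by blast
qed simp

lemma poly_below_smult:
  assumes "subring A" "a \<in> A"
  shows "x \<in> poly_below A t n \<Longrightarrow> a * x \<in> poly_below A t n"
proof (induction n arbitrary: x)
  case (Suc n)
  then obtain x' c where *: "x = x' + c * t ^ n" "c \<in> A" "x' \<in> poly_below A t n" by auto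
  then have "a * x = a * x' + (a * c) * t ^ n" "a * c \<in> A"
    using assms by (auto simp: algebra_simps subring_def)
  with * Suc.IH show ?case unfolding poly_below.simps by blast
qed simp

lemma poly_below_shift:
  assumes "subring A"
  shows "x \<in> poly_below A t n \<Longrightarrow> t ^ k * x \<in> poly_below A t (k + n)"
proof (induction n arbitrary: x)
  case 0
  then show ?case using poly_below_zero[OF assms] by simp
next
  case (Suc n)
  then obtain x' c where *: "x = x' + c * t ^ n" "c \<in> A" "x' \<in> poly_below A t n" by auto
  then have "t ^ k * x = t ^ k * x' + c * t ^ (k + n)"
    by (simp add: algebra_simps power_add)
  with * Suc.IH show ?case unfolding poly_below.simps add_Suc_right by blast
qed

lemma poly_below_mult:
  assumes "subring A" "x \<in> poly_below A t m"
  shows "y \<in> poly_below A t n \<Longrightarrow> x * y \<in> poly_below A t (n + m)"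
proof (induction n arbitrary: y)
  case 0
  then show ?case using poly_below_zero[OF assms(1)] by simp
next
  case (Suc n)
  then obtain y' c where *: "y = y' + c * t ^ n" "c \<in> A" "y' \<in> poly_below A t n" by auto
  have "x * y = x * y' + t ^ n * (c * x)"
    using * by (simp add: algebra_simps)
  moreover have "x * y' \<in> poly_below A t (Suc n + m)"
    using Suc.IH[OF *(3)] poly_below_Suc[OF assms(1)] by simp
  moreover have "t ^ n * (c * x) \<in> poly_below A t (Suc n + m)"
    using poly_below_shift[OF assms(1) poly_below_smult[OF assms(1) *(2) assms(2)]]
      poly_below_Suc[OF assms(1)] by simp
  ultimately show ?case using poly_below_add[OF assms(1)] by metis
qed

lemma poly_below_uminus:
  assumes "subring A" "x \<in> poly_below A t n" shows "- x \<in> poly_below A t n"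
proof -
  have "(- 1) * x \<in> poly_below A t n"
    using assms by (intro poly_below_smult) (auto simp: subring_def)
  then show ?thesis by simp
qed

lemma adjoin_base:
  assumes "subring A" shows "A \<subseteq> adjoin A t"
proof
  fix c assume "c \<in> A"
  then have "c \<in> poly_below A t 1"
    by (auto intro!: exI[of _ c])
  then show "c \<in> adjoin A t" unfolding adjoin_def by blast
qed

lemma adjoin_generator:
  assumes "subring A" shows "t \<in> adjoin A t"
proof -
  have "t = 0 + 1 * t ^ 1" "0 \<in> poly_below A t 1" "1 \<in> A"
    using assms poly_below_zero[OF assms] by (auto simp: subring_def)
  then have "t \<in> poly_below A t (Suc 1)" unfolding poly_below.simps(2)[of A t 1] by blast
  then show ?thesis unfolding adjoin_def by blast
qed

lemma subring_adjoin:
  assumes "subring A" shows "subring (adjoin A t)"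
proof -
  have "x + y \<in> adjoin A t" "x * y \<in> adjoin A t" if "x \<in> adjoin A t" "y \<in> adjoin A t" for x y
  proof -
    from that obtain m n where mn: "x \<in> poly_below A t m" "y \<in> poly_below A t n"
      unfolding adjoin_def by blast
    then have "x \<in> poly_below A t (max m n)" "y \<in> poly_below A t (max m n)"
      by (auto intro: poly_below_mono[OF assms max.cobounded1] poly_below_mono[OF assms max.cobounded2])
    then show "x + y \<in> adjoin A t"
      unfolding adjoin_def using poly_below_add[OF assms] by blast
    show "x * y \<in> adjoin A t"
      unfolding adjoin_def using poly_below_mult[OF assms mn] by blast
  qed
  moreover have "- x \<in> adjoin A t" if "x \<in> adjoin A t" for x
    using that poly_below_uminus[OF assms] unfolding adjoin_def by blast
  moreover have "0 \<in> adjoin A t" "1 \<in> adjoin A t"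
    using adjoin_base[OF assms, of t] assms by (auto simp: subring_def)
  ultimately show ?thesis unfolding subring_def by blast
qed

text \<open>If no finite part of \<open>F\<close> generated \<open>F\<close>, one could choose
  forever an element \<open>g k\<close> of least degree outside the ideal of the earlier ones. As
  \<open>A\<close> is Noetherian, some leading coefficient is a combination of earlier ones;
  subtracting the corresponding combination of the elements lowers the degree but stays outside that
  ideal.\<close>

theorem hilbert_basis:
  assumes A: "subring A" and noeth: "noetherian A"
  shows "noetherian (adjoin A t)"
proof -
  let ?B = "adjoin A t"
  have B: "subring ?B" by (rule subring_adjoin[OF A])
  have tB: "t ^ k \<in> ?B" for k
    using B adjoin_generator[OF A, of t] by (induction k) (auto simp: subring_def)
  have "\<exists>G\<subseteq>F. finite G \<and> F \<subseteq> ideal_gen ?B G" if "F \<subseteq> ?B" for F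
  proof (rule ccontr)
    assume bad: "\<not> ?thesis"
    define I where "I = ideal_gen ?B F"
    have IB: "I \<subseteq> ?B" unfolding I_def by (rule ideal_gen_subset[OF B that])
    \<comment> \<open>The shortest representation is measured, as there may be several. The value is
      one more than the usual degree, and within the ring only the zero element has value 0.\<close>
    define deg where "deg x = (LEAST n. x \<in> poly_below A t n)" for x
    have deg: "x \<in> poly_below A t (deg x)" if "x \<in> ?B" for x
      using that LeastI_ex[of "\<lambda>n. x \<in> poly_below A t n"] unfolding adjoin_def deg_def by blast
    have deg_le: "deg x \<le> n" if "x \<in> poly_below A t n" for x n
      using that unfolding deg_def by (rule Least_le)
    \<comment> \<open>Each member of \<open>H\<close> involves finitely many elements of
      \<open>F\<close>; if \<open>H\<close> generated \<open>I\<close>, these elements would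
      generate \<open>F\<close>, against \<open>bad\<close>.\<close>
    have ne: "\<exists>x. x \<in> I \<and> x \<notin> ideal_gen ?B H" if H: "finite H" "H \<subseteq> I" for H
    proof (rule ccontr)
      assume "\<not> ?thesis"
      then have "I \<subseteq> ideal_gen ?B H" by blast
      moreover obtain G where "finite G" "G \<subseteq> F" "H \<subseteq> ideal_gen ?B G"
        using ideal_gen_finite_set H unfolding I_def by blast
      ultimately show False
        using bad ideal_gen_trans[OF B] ideal_gen_superset[OF B, of F] unfolding I_def
        by (meson subset_iff)
    qed
    define pick where "pick H = (ARG_MIN deg x. x \<in> I \<and> x \<notin> ideal_gen ?B H)" for H
    have pick: "pick H \<in> I" "pick H \<notin> ideal_gen ?B H"
      and pick_min: "x \<in> I \<Longrightarrow> x \<notin> ideal_gen ?B H \<Longrightarrow> deg (pick H) \<le> deg x"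
      if "finite H" "H \<subseteq> I" for H x
      using arg_min_nat_lemma[of "\<lambda>x. x \<in> I \<and> x \<notin> ideal_gen ?B H" _ deg] ne[OF that]
      unfolding pick_def by blast+
    define S where "S = rec_nat {} (\<lambda>_ H. insert (pick H) H)"
    have S0: "S 0 = {}" and SS: "S (Suc k) = insert (pick (S k)) (S k)" for k
      unfolding S_def by simp_all
    define g where "g k = pick (S k)" for k
    have S_eq: "S k = g ` {..<k}" for k
      by (induction k) (auto simp: S0 SS g_def lessThan_Suc)
    have fin: "finite (S k)" for k by (simp add: S_eq)
    have SI: "S k \<subseteq> I" for k
      by (induction k) (use S0 SS fin pick in auto)
    have gI: "g k \<in> I" and g_not: "g k \<notin> ideal_gen ?B (S k)" for k
      unfolding g_def using pick[OF fin SI] by auto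
    have g_min: "deg (g k) \<le> deg x" if "x \<in> I" "x \<notin> ideal_gen ?B (S k)" for k x
      unfolding g_def using pick_min[OF fin SI] that by auto
    have S_mono: "i \<le> k \<Longrightarrow> S i \<subseteq> S k" for i k
      unfolding S_eq by auto
    have deg_mono: "deg (g i) \<le> deg (g k)" if "i \<le> k" for i k
      using that by (meson S_mono gI g_min g_not ideal_gen_mono)
    have gB: "g k \<in> ?B" for k using gI IB by auto
    have deg_pos: "deg (g k) > 0" for k
    proof (rule ccontr)
      assume "\<not> ?thesis"
      then have "g k = 0" using deg[OF gB, of k] by simp
      then show False using g_not[of k] ideal_gen.zero by metis
    qed
    define e where "e k = deg (g k) - 1" for k
    have deg_e: "deg (g k) = Suc (e k)" for k using deg_pos[of k] by (simp add: e_def)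
    \<comment> \<open>The leading coefficient of \<open>g k\<close> is read off from one shortest
      representation.\<close>
    have "\<forall>k. \<exists>c. c \<in> A \<and> g k - c * t ^ e k \<in> poly_below A t (e k)"
    proof
      fix k
      from deg[OF gB, of k] obtain x c where "g k = x + c * t ^ e k" "x \<in> poly_below A t (e k)" "c \<in> A"
        unfolding deg_e by auto
      then show "\<exists>c. c \<in> A \<and> g k - c * t ^ e k \<in> poly_below A t (e k)" by auto
    qed
    then obtain a where a: "\<And>k. a k \<in> A" "\<And>k. g k - a k * t ^ e k \<in> poly_below A t (e k)"
      by metis
    have "range a \<subseteq> A" using a by auto
    then obtain G where G: "G \<subseteq> range a" "finite G" "range a \<subseteq> ideal_gen A G"
      using noeth unfolding noetherian_def by meson
    from finite_subset_image[OF G(2,1)] obtain K where K: "finite K" "G = a ` K" by auto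
    \<comment> \<open>This exceeds every index in \<open>K\<close>, so \<open>a m\<close> becomes a
      combination of earlier coefficients. Inserting 0 covers an empty \<open>K\<close>.\<close>
    define m where "m = Suc (Max (insert 0 K))"
    have "K \<subseteq> {..<m}" using K by (auto simp: m_def less_Suc_eq_le)
    then have "G \<subseteq> a ` {..<m}" using K by auto
    with G(3) have am: "a m \<in> ideal_gen A (a ` {..<m})"
      using ideal_gen_mono by blast
    \<comment> \<open>A relation between coefficients lifts to the elements: \<open>g i\<close> is
      multiplied by the missing power of \<open>t\<close>, which exists because the degrees do not
      decrease along the sequence.\<close>
    have lift: "\<exists>w. w \<in> ideal_gen ?B (S m) \<and> w - y * t ^ e m \<in> poly_below A t (e m)"
      if "y \<in> ideal_gen A (a ` {..<m})" for y
      using that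
    proof induction
      case zero
      show ?case by (rule exI[of _ 0]) (simp add: ideal_gen.zero poly_below_zero[OF A])
    next
      case (step b c y)
      then obtain w i where w: "w \<in> ideal_gen ?B (S m)" "w - y * t ^ e m \<in> poly_below A t (e m)"
        and i: "i < m" "c = a i" by blast
      from i have ei: "e i \<le> e m" using deg_mono[of i m] by (simp add: e_def)
      define k where "k = e m - e i"
      have k: "e m = k + e i" using ei by (simp add: k_def)
      let ?w = "(b * t ^ k) * g i + w"
      have "g i \<in> S m" using i unfolding S_eq by auto
      moreover have "b * t ^ k \<in> ?B"
        using B tB[of k] subsetD[OF adjoin_base[OF A, of t] step.hyps(1)] unfolding subring_def by blast
      ultimately have "?w \<in> ideal_gen ?B (S m)"
        using w(1) by (intro ideal_gen.step) auto
      moreover have "?w - (b * c + y) * t ^ e m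
          = b * (t ^ k * (g i - a i * t ^ e i)) + (w - y * t ^ e m)"
        unfolding k i by (simp add: algebra_simps power_add)
      moreover have "\<dots> \<in> poly_below A t (e m)"
        by (rule poly_below_add[OF A poly_below_smult[OF A step.hyps(1)] w(2)])
          (use poly_below_shift[OF A a(2)[of i], of k] k in simp)
      ultimately show ?case by metis
    qed
    from lift[OF am] obtain w where w: "w \<in> ideal_gen ?B (S m)"
      "w - a m * t ^ e m \<in> poly_below A t (e m)" by auto
    have "g m - w = (g m - a m * t ^ e m) + - (w - a m * t ^ e m)" by simp
    also have "\<dots> \<in> poly_below A t (e m)"
      by (intro poly_below_add[OF A] poly_below_uminus[OF A] a(2) w(2))
    finally have "deg (g m - w) \<le> e m" by (rule deg_le)
    \<comment> \<open>The difference lies in \<open>I\<close> but not in the ideal of the earlier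
      elements, so the minimal choice of \<open>g m\<close> contradicts the drop in degree.\<close>
    moreover have "deg (g m) \<le> deg (g m - w)"
    proof (rule g_min)
      have "w \<in> I"
        using w(1) SI[of m] ideal_gen_trans[OF B, of w "S m" F] unfolding I_def by auto
      then show "g m - w \<in> I"
        unfolding I_def using gI[of m] ideal_gen_diff[OF B] unfolding I_def by blast
      show "g m - w \<notin> ideal_gen ?B (S m)"
      proof
        assume "g m - w \<in> ideal_gen ?B (S m)"
        from ideal_gen_add[OF this w(1)] show False using g_not[of m] by simp
      qed
    qed
    ultimately show False using deg_e[of m] by simp
  qed
  then show ?thesis unfolding noetherian_def by blast
qed

section \<open>Polynomial functions on a Euclidean space\<close>

lemma noetherian_constants:
  "noetherian (range (\<lambda>c _. c) :: ('a \<Rightarrow> 'k::field) set)"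
proof -
  let ?A = "range (\<lambda>c _. c) :: ('a \<Rightarrow> 'k) set"
  have "\<exists>G\<subseteq>F. finite G \<and> F \<subseteq> ideal_gen ?A G" if "F \<subseteq> ?A" for F
  proof (cases "\<exists>c. c \<noteq> 0 \<and> (\<lambda>_. c) \<in> F")
    case True
    then obtain c where c: "c \<noteq> 0" "(\<lambda>_. c) \<in> F" by auto
    have "F \<subseteq> ideal_gen ?A {\<lambda>_. c}"
    proof
      fix f assume "f \<in> F"
      with that obtain b where b: "f = (\<lambda>_. b)" by auto
      have "(\<lambda>_. b / c) * (\<lambda>_. c) + 0 \<in> ideal_gen ?A {\<lambda>_. c}"
        by (intro ideal_gen.intros) auto
      moreover have "(\<lambda>_. b / c) * (\<lambda>_. c) + 0 = f"
        using c b by (auto simp: fun_eq_iff)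
      ultimately show "f \<in> ideal_gen ?A {\<lambda>_. c}" by metis
    qed
    then show ?thesis using c by (intro exI[of _ "{\<lambda>_. c}"]) auto
  next
    case False
    have "F \<subseteq> {0}"
    proof
      fix f assume "f \<in> F"
      with that obtain b where "f = (\<lambda>_. b)" by auto
      with False \<open>f \<in> F\<close> show "f \<in> {0}" by (auto simp: fun_eq_iff)
    qed
    then show ?thesis by (intro exI[of _ "{}"]) (auto intro: ideal_gen.zero)
  qed
  then show ?thesis unfolding noetherian_def by blast
qed

text \<open>Starting from the constants, the coordinates along the basis are adjoined one at a
  time.\<close>

lemma noetherian_ring_of_polynomials:
  "\<exists>A :: ('a::euclidean_space \<Rightarrow> real) set. subring A \<and> noetherian A \<and> {f. real_polynomial_function f} \<subseteq> A"
proof -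
  have "\<exists>A :: ('a \<Rightarrow> real) set. subring A \<and> noetherian A \<and> range (\<lambda>c _. c) \<subseteq> A \<and> (\<forall>b\<in>S. (\<lambda>x. x \<bullet> b) \<in> A)"
    if "finite S" for S
    using that
  proof induction
    case empty
    have "subring (range (\<lambda>c _. c) :: ('a \<Rightarrow> real) set)"
      unfolding subring_def zero_fun_def one_fun_def plus_fun_def times_fun_def fun_Compl_def by auto
    then show ?case using noetherian_constants by blast
  next
    case (insert b S)
    then obtain A :: "('a \<Rightarrow> real) set" where A: "subring A" "noetherian A" "range (\<lambda>c _. c) \<subseteq> A"
      "\<forall>b\<in>S. (\<lambda>x. x \<bullet> b) \<in> A" by auto
    let ?t = "\<lambda>x. x \<bullet> b"
    show ?case
      using subring_adjoin[OF A(1), of ?t] hilbert_basis[OF A(1,2), of ?t]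
        adjoin_base[OF A(1), of ?t] adjoin_generator[OF A(1), of ?t] A(3,4)
      by (intro exI[of _ "adjoin A ?t"]) auto
  qed
  from this[OF finite_Basis] obtain A :: "('a \<Rightarrow> real) set" where A: "subring A" "noetherian A"
    "range (\<lambda>c _. c) \<subseteq> A" "\<forall>b\<in>Basis. (\<lambda>x. x \<bullet> b) \<in> A" by auto
  have add: "(\<lambda>x. f x + g x) \<in> A" and mult: "(\<lambda>x. f x * g x) \<in> A" if "f \<in> A" "g \<in> A" for f g
    using that A(1) unfolding subring_def plus_fun_def times_fun_def by auto
  have sum: "(\<lambda>x. \<Sum>b\<in>S. f b x) \<in> A" if "finite S" "\<And>b. b \<in> S \<Longrightarrow> f b \<in> A" for S :: "'a set" and f
    using that by (induction S) (use A(3) add in auto)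
  have "f \<in> A" if "real_polynomial_function f" for f
    using that
  proof induction
    case (linear f)
    have "f = (\<lambda>x. \<Sum>b\<in>Basis. (x \<bullet> b) * f b)"
    proof
      fix x
      have "f x = f (\<Sum>b\<in>Basis. (x \<bullet> b) *\<^sub>R b)" by (simp add: euclidean_representation)
      also have "\<dots> = (\<Sum>b\<in>Basis. (x \<bullet> b) * f b)"
        using linear by (simp add: bounded_linear.linear linear_sum linear_cmul)
      finally show "f x = (\<Sum>b\<in>Basis. (x \<bullet> b) * f b)" .
    qed
    moreover have "(\<lambda>x. \<Sum>b\<in>Basis. (x \<bullet> b) * f b) \<in> A"
      using A(3,4) by (intro sum mult) auto
    ultimately show ?case by simp
  qed (use A(3) add mult in auto)
  with A show ?thesis by blast
qed

text \<open>Every function in the ideal generated by \<open>G\<close> vanishes at the common zeros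
  of \<open>G\<close>.\<close>

lemma finite_polynomial_subfamily:
  fixes F :: "('a::euclidean_space \<Rightarrow> real) set"
  assumes "\<And>f. f \<in> F \<Longrightarrow> real_polynomial_function f"
  obtains G where "finite G" "G \<subseteq> F" "\<And>x. (\<forall>f\<in>G. f x = 0) \<longleftrightarrow> (\<forall>f\<in>F. f x = 0)"
proof -
  obtain A :: "('a \<Rightarrow> real) set" where A: "subring A" "noetherian A" "{f. real_polynomial_function f} \<subseteq> A"
    using noetherian_ring_of_polynomials by blast
  with assms have "F \<subseteq> A" by auto
  then obtain G where G: "G \<subseteq> F" "finite G" "F \<subseteq> ideal_gen A G"
    using A(2) unfolding noetherian_def by meson
  have "f x = 0" if "f \<in> ideal_gen A G" "\<forall>g\<in>G. g x = 0" for f x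
    using that by induction auto
  with G show ?thesis by (intro that[of G]) blast+
qed

section \<open>Algebraic sets and Zariski closures\<close>

lemma algebraic_set_zeros:
  assumes "\<And>f. f \<in> F \<Longrightarrow> real_polynomial_function f"
  shows "algebraic_set {x. \<forall>f\<in>F. f x = 0}"
proof -
  obtain G where "finite G" "G \<subseteq> F" "\<And>x. (\<forall>f\<in>G. f x = 0) \<longleftrightarrow> (\<forall>f\<in>F. f x = 0)"
    using finite_polynomial_subfamily[of F] assms by blast
  then show ?thesis
    unfolding algebraic_set_def using assms by (intro exI[of _ G]) auto
qed

text \<open>The closure is an intersection of possibly infinitely many algebraic sets. It equals the
  zero set of all polynomials that vanish on \<open>X\<close>, and the basis theorem makes this
  system finite.\<close>

lemma algebraic_set_zariski_closure: "algebraic_set (zariski_closure X)"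
proof -
  let ?F = "{f. real_polynomial_function f \<and> (\<forall>x\<in>X. f x = 0)}"
  have "zariski_closure X = {x. \<forall>f\<in>?F. f x = 0}" (is "_ = ?Z")
  proof
    have "algebraic_set ?Z" by (rule algebraic_set_zeros) auto
    then show "zariski_closure X \<subseteq> ?Z" unfolding zariski_closure_def by auto
    show "?Z \<subseteq> zariski_closure X"
      unfolding zariski_closure_def
    proof (rule Inter_greatest)
      fix A assume "A \<in> {A. algebraic_set A \<and> X \<subseteq> A}"
      then obtain F where F: "\<forall>f\<in>F. real_polynomial_function f" "A = {x. \<forall>f\<in>F. f x = 0}" "X \<subseteq> A"
        unfolding algebraic_set_def by blast
      then have "F \<subseteq> ?F" by auto
      then show "?Z \<subseteq> A" using F(2) by auto
    qed
  qed
  moreover have "algebraic_set ?Z" by (rule algebraic_set_zeros) simp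
  ultimately show ?thesis by simp
qed

text \<open>The hypothesis is primality of the vanishing ideal of \<open>X\<close>, with the unit
  ideal allowed. If neither part of a decomposition contained \<open>X\<close>, a polynomial
  vanishing on one part but not on \<open>X\<close> and a similar one for the other part would have
  a product vanishing on \<open>X\<close>.\<close>

lemma irreducible_zariski_closure:
  assumes "\<And>f g. real_polynomial_function f \<Longrightarrow> real_polynomial_function g \<Longrightarrow>
      (\<forall>x\<in>X. f x * g x = 0) \<Longrightarrow> (\<forall>x\<in>X. f x = 0) \<or> (\<forall>x\<in>X. g x = 0)"
  shows "irreducible_algebraic_set (zariski_closure X)"
proof -
  have "zariski_closure X \<subseteq> A \<or> zariski_closure X \<subseteq> B"
    if AB: "algebraic_set A" "algebraic_set B" and eq: "zariski_closure X = A \<union> B" for A B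
  proof (rule ccontr)
    assume "\<not> ?thesis"
    then have "\<not> X \<subseteq> A" "\<not> X \<subseteq> B"
      using AB unfolding zariski_closure_def by blast+
    have separate: "\<exists>f. real_polynomial_function f \<and> (\<forall>x\<in>A. f x = 0) \<and> \<not> (\<forall>x\<in>X. f x = 0)"
      if "algebraic_set A" "\<not> X \<subseteq> A" for A
    proof -
      from that(1) obtain F where "\<forall>f\<in>F. real_polynomial_function f" "A = {x. \<forall>f\<in>F. f x = 0}"
        unfolding algebraic_set_def by blast
      with that(2) show ?thesis by blast
    qed
    obtain f where f: "real_polynomial_function f" "\<forall>x\<in>A. f x = 0" "\<not> (\<forall>x\<in>X. f x = 0)"
      using separate[OF AB(1) \<open>\<not> X \<subseteq> A\<close>] by blast
    obtain g where g: "real_polynomial_function g" "\<forall>x\<in>B. g x = 0" "\<not> (\<forall>x\<in>X. g x = 0)"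
      using separate[OF AB(2) \<open>\<not> X \<subseteq> B\<close>] by blast
    have "X \<subseteq> A \<union> B" using eq unfolding zariski_closure_def by blast
    then have "\<forall>x\<in>X. f x * g x = 0" using f(2) g(2) by auto
    from assms[OF f(1) g(1) this] f(3) g(3) show False by blast
  qed
  then show ?thesis
    unfolding irreducible_algebraic_set_def using algebraic_set_zariski_closure by blast
qed

section \<open>Polynomial orthogonal projections\<close>

text \<open>Gram-Schmidt without divisions: \<open>orth as\<close> is \<open>orth_factor as\<close> times the orthogonal projection
  onto the complement of \<open>as\<close>, and \<open>orth_factor as\<close> vanishes when \<open>as\<close> is dependent.\<close>

primrec orth :: "'b::real_inner list \<Rightarrow> 'b \<Rightarrow> 'b" where
  "orth [] y = y"
| "orth (a # as) y = (orth as a \<bullet> orth as a) *\<^sub>R orth as y - (orth as y \<bullet> orth as a) *\<^sub>R orth as a"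

primrec orth_factor :: "'b::real_inner list \<Rightarrow> real" where
  "orth_factor [] = 1"
| "orth_factor (a # as) = orth_factor as * (orth as a \<bullet> orth as a)"

text \<open>One simultaneous induction, because the three properties rely on one another for the
  shorter list.\<close>

lemma orth_properties:
  shows orth_selfadjoint: "orth as y \<bullet> z = y \<bullet> orth as z"
    and orth_orthogonal: "b \<in> set as \<Longrightarrow> orth as y \<bullet> b = 0"
    and orth_eq_factor: "(\<And>b. b \<in> set as \<Longrightarrow> y \<bullet> b = 0) \<Longrightarrow> orth as y = orth_factor as *\<^sub>R y"
proof -
  have "(\<forall>y z. orth as y \<bullet> z = y \<bullet> orth as z) \<and> (\<forall>y. \<forall>b\<in>set as. orth as y \<bullet> b = 0) \<and>
      (\<forall>y. (\<forall>b\<in>set as. y \<bullet> b = 0) \<longrightarrow> orth as y = orth_factor as *\<^sub>R y)"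
  proof (induction as)
    case Nil
    then show ?case by simp
  next
    case (Cons a as)
    then have adj: "\<And>y z. orth as y \<bullet> z = y \<bullet> orth as z"
      and perp: "\<And>y b. b \<in> set as \<Longrightarrow> orth as y \<bullet> b = 0"
      and fac: "\<And>y. (\<And>b. b \<in> set as \<Longrightarrow> y \<bullet> b = 0) \<Longrightarrow> orth as y = orth_factor as *\<^sub>R y"
      by auto
    define w where "w = orth as a"
    \<comment> \<open>The vector \<open>w\<close> is already orthogonal to \<open>as\<close>, so the
      projection only scales it; self-adjointness moves this scaling to the other side.\<close>
    have Pw: "orth as y \<bullet> w = orth_factor as * (y \<bullet> w)" for y
      using adj[of y w] fac[of w] perp[of _ a] by (simp add: w_def)
    have ww: "w \<bullet> w = orth_factor as * (w \<bullet> a)"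
      using Pw[of a] by (simp add: w_def inner_commute)
    have "orth (a # as) y \<bullet> z = y \<bullet> orth (a # as) z" for y z
      by (simp add: w_def[symmetric] inner_diff_left inner_diff_right adj[of y z] Pw inner_commute[of w z])
    moreover have "orth (a # as) y \<bullet> b = 0" if "b \<in> set (a # as)" for y b
    proof (cases "b \<in> set as")
      case True
      then show ?thesis
        using perp[of b y] perp[of b a] by (simp add: inner_diff_left)
    next
      case False
      with that have "b = a" by simp
      then show ?thesis
        using Pw[of y] adj[of y a] by (simp add: w_def[symmetric] inner_diff_left ww)
    qed
    moreover have "orth (a # as) y = orth_factor (a # as) *\<^sub>R y"
      if "\<And>b. b \<in> set (a # as) \<Longrightarrow> y \<bullet> b = 0" for y
    proof -
      have Py: "orth as y = orth_factor as *\<^sub>R y" using fac that by simp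
      then have "y \<bullet> w = 0" using adj[of y a] that[of a] by (simp add: w_def)
      with Py show ?thesis by (simp add: w_def[symmetric])
    qed
    ultimately show ?case by blast
  qed
  then show "orth as y \<bullet> z = y \<bullet> orth as z"
    "b \<in> set as \<Longrightarrow> orth as y \<bullet> b = 0"
    "(\<And>b. b \<in> set as \<Longrightarrow> y \<bullet> b = 0) \<Longrightarrow> orth as y = orth_factor as *\<^sub>R y"
    by blast+
qed

lemma orth_mem_subspace:
  assumes "subspace S" "set as \<subseteq> S" "y \<in> S"
  shows "orth as y \<in> S"
  using assms(2,3)
proof (induction as arbitrary: y)
  case (Cons a as)
  then show ?case
    by (auto intro!: subspace_diff[OF assms(1)] subspace_scale[OF assms(1)])
qed simp

text \<open>The projection changes a multiple of \<open>y\<close> only by a combination of the list.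
  Distinct indices allow the coefficients to be a function of the index.\<close>

lemma orth_eq_combination:
  assumes "distinct xs"
  shows "\<exists>\<mu>. orth (map a xs) y = orth_factor (map a xs) *\<^sub>R y - (\<Sum>i\<in>set xs. \<mu> i *\<^sub>R a i)"
  using assms
proof (induction xs arbitrary: y)
  case Nil
  then show ?case by simp
next
  case (Cons x xs)
  let ?c = "orth_factor (map a xs)"
  let ?w = "orth (map a xs) (a x)" and ?v = "orth (map a xs) y"
  obtain \<mu> where \<mu>: "?v = ?c *\<^sub>R y - (\<Sum>i\<in>set xs. \<mu> i *\<^sub>R a i)" using Cons by auto
  obtain \<nu> where \<nu>: "?w = ?c *\<^sub>R a x - (\<Sum>i\<in>set xs. \<nu> i *\<^sub>R a i)" using Cons by auto
  define \<kappa> where "\<kappa> i = (if i = x then (?v \<bullet> ?w) * ?c else (?w \<bullet> ?w) * \<mu> i - (?v \<bullet> ?w) * \<nu> i)" for i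
  have "(\<Sum>i\<in>set xs. \<kappa> i *\<^sub>R a i) = (\<Sum>i\<in>set xs. ((?w \<bullet> ?w) * \<mu> i - (?v \<bullet> ?w) * \<nu> i) *\<^sub>R a i)"
    using Cons.prems by (intro sum.cong) (auto simp: \<kappa>_def)
  also have "\<dots> = (?w \<bullet> ?w) *\<^sub>R (\<Sum>i\<in>set xs. \<mu> i *\<^sub>R a i) - (?v \<bullet> ?w) *\<^sub>R (\<Sum>i\<in>set xs. \<nu> i *\<^sub>R a i)"
    by (simp add: scaleR_sum_right sum_subtractf algebra_simps)
  finally have \<kappa>: "(\<Sum>i\<in>set (x # xs). \<kappa> i *\<^sub>R a i) = ((?v \<bullet> ?w) * ?c) *\<^sub>R a x +
      ((?w \<bullet> ?w) *\<^sub>R (\<Sum>i\<in>set xs. \<mu> i *\<^sub>R a i) - (?v \<bullet> ?w) *\<^sub>R (\<Sum>i\<in>set xs. \<nu> i *\<^sub>R a i))"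
    using Cons.prems by (simp add: \<kappa>_def)
  have eq: "r *\<^sub>R ?v - s *\<^sub>R ?w = r *\<^sub>R (?c *\<^sub>R y - (\<Sum>i\<in>set xs. \<mu> i *\<^sub>R a i))
      - s *\<^sub>R (?c *\<^sub>R a x - (\<Sum>i\<in>set xs. \<nu> i *\<^sub>R a i))" for r s
    by (simp only: \<mu>[symmetric] \<nu>[symmetric])
  have "orth (map a (x # xs)) y = (?w \<bullet> ?w) *\<^sub>R ?v - (?v \<bullet> ?w) *\<^sub>R ?w" by simp
  also have "\<dots> = (?w \<bullet> ?w) *\<^sub>R (?c *\<^sub>R y - (\<Sum>i\<in>set xs. \<mu> i *\<^sub>R a i))
      - (?v \<bullet> ?w) *\<^sub>R (?c *\<^sub>R a x - (\<Sum>i\<in>set xs. \<nu> i *\<^sub>R a i))"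
    by (rule eq)
  also have "\<dots> = (?c * (?w \<bullet> ?w)) *\<^sub>R y - (\<Sum>i\<in>set (x # xs). \<kappa> i *\<^sub>R a i)"
    unfolding \<kappa> by (simp add: algebra_simps)
  finally show ?case by auto
qed

text \<open>If the residue of a new vector were 0, \<open>orth_eq_combination\<close> would be a
  relation in which that vector has the nonzero coefficient \<open>?c\<close>. Independence concerns
  the indexed family, so repeated vectors count as dependent.\<close>

lemma orth_factor_nonzero:
  assumes "distinct xs"
    and "\<And>\<kappa>. (\<Sum>i\<in>set xs. \<kappa> i *\<^sub>R a i) = 0 \<Longrightarrow> \<forall>i\<in>set xs. \<kappa> i = 0"
  shows "orth_factor (map a xs) \<noteq> 0"
  using assms
proof (induction xs)
  case Nil
  then show ?case by simp
next
  case (Cons x xs)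
  let ?c = "orth_factor (map a xs)"
  have "\<forall>i\<in>set xs. \<kappa> i = 0" if "(\<Sum>i\<in>set xs. \<kappa> i *\<^sub>R a i) = 0" for \<kappa>
  proof -
    have "(\<Sum>i\<in>set (x # xs). (if i = x then 0 else \<kappa> i) *\<^sub>R a i) = (\<Sum>i\<in>set xs. \<kappa> i *\<^sub>R a i)"
      using Cons.prems(1) by (simp, intro sum.cong) auto
    with that have "\<forall>i\<in>set (x # xs). (if i = x then 0 else \<kappa> i) = 0"
      by (intro Cons.prems(2)) simp
    then show ?thesis using Cons.prems(1) by (auto split: if_splits)
  qed
  with Cons.prems(1) have c: "?c \<noteq> 0" by (intro Cons.IH) simp_all
  have "orth (map a xs) (a x) \<noteq> 0"
  proof
    assume 0: "orth (map a xs) (a x) = 0"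
    obtain \<mu> where "orth (map a xs) (a x) = ?c *\<^sub>R a x - (\<Sum>i\<in>set xs. \<mu> i *\<^sub>R a i)"
      using orth_eq_combination[of xs a "a x"] Cons.prems(1) by auto
    with 0 have eq: "?c *\<^sub>R a x - (\<Sum>i\<in>set xs. \<mu> i *\<^sub>R a i) = 0" by simp
    have "(\<Sum>i\<in>set xs. (if i = x then ?c else - \<mu> i) *\<^sub>R a i) = (\<Sum>i\<in>set xs. - \<mu> i *\<^sub>R a i)"
      using Cons.prems(1) by (intro sum.cong) auto
    then have "(\<Sum>i\<in>set (x # xs). (if i = x then ?c else - \<mu> i) *\<^sub>R a i) = 0"
      using Cons.prems(1) eq by (simp add: sum_negf)
    from Cons.prems(2)[OF this] c show False by auto
  qed
  with c show ?case by simp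
qed

section \<open>Polynomial functions with vector values\<close>

lemma polynomial_function_inner':
  fixes f g :: "'a::real_normed_vector \<Rightarrow> 'b::euclidean_space"
  assumes "polynomial_function f" "polynomial_function g"
  shows "real_polynomial_function (\<lambda>x. f x \<bullet> g x)"
proof -
  have "(\<lambda>x. f x \<bullet> g x) = (\<lambda>x. \<Sum>b\<in>Basis. (f x \<bullet> b) * (g x \<bullet> b))"
    by (rule ext) (rule euclidean_inner)
  moreover have "real_polynomial_function (\<lambda>x. \<Sum>b\<in>Basis. (f x \<bullet> b) * (g x \<bullet> b))"
    using assms unfolding polynomial_function_iff_Basis_inner
    by (intro real_polynomial_function_sum real_polynomial_function.intros(4) finite_Basis) blast+
  ultimately show ?thesis by simp
qed

lemma polynomial_function_vec:
  fixes f :: "'a::real_normed_vector \<Rightarrow> 'b::euclidean_space ^ 'n"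
  assumes "\<And>i. polynomial_function (\<lambda>x. f x $ i)"
  shows "polynomial_function f"
  unfolding polynomial_function_iff_Basis_inner
proof
  fix b :: "'b ^ 'n" assume "b \<in> Basis"
  then obtain i u where b: "b = axis i u" "u \<in> Basis" by (auto simp: Basis_vec_def)
  from assms[of i] b(2) show "real_polynomial_function (\<lambda>x. f x \<bullet> b)"
    unfolding polynomial_function_iff_Basis_inner b(1) inner_axis by blast
qed

lemma polynomial_function_vec_nth:
  assumes "polynomial_function f"
  shows "polynomial_function (\<lambda>x. f x $ i)"
  using polynomial_function_compose[OF assms polynomial_function_bounded_linear[OF bounded_linear_vec_nth]]
  by (simp add: o_def)

lemma real_polynomial_function_vec_nth:
  assumes "polynomial_function f"
  shows "real_polynomial_function (\<lambda>x. f x $ i :: real)"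
  using polynomial_function_vec_nth[OF assms] by (simp add: real_polynomial_function_eq)

lemma real_polynomial_function_det:
  fixes f :: "'a::real_normed_vector \<Rightarrow> real^'n^'n"
  assumes "\<And>i j. real_polynomial_function (\<lambda>x. f x $ i $ j)"
  shows "real_polynomial_function (\<lambda>x. det (f x))"
proof -
  have "real_polynomial_function (\<lambda>x. of_int (sign p) * (\<Prod>i\<in>UNIV. f x $ i $ p i))" for p
    by (rule real_polynomial_function.intros(4)[OF real_polynomial_function.intros(2)
          real_polynomial_function_prod[OF finite assms]])
  then show ?thesis
    unfolding det_def by (intro real_polynomial_function_sum) (simp_all add: finite_permutations)
qed

lemma polynomial_function_orth:
  fixes a :: "'i \<Rightarrow> 'a::real_normed_vector \<Rightarrow> 'b::euclidean_space"
  assumes "\<And>i. i \<in> set xs \<Longrightarrow> polynomial_function (a i)"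
  shows "polynomial_function y \<Longrightarrow> polynomial_function (\<lambda>x. orth (map (\<lambda>i. a i x) xs) (y x))"
  using assms
proof (induction xs arbitrary: y)
  case (Cons i xs)
  then have "polynomial_function (\<lambda>x. orth (map (\<lambda>i. a i x) xs) (y x))"
    "polynomial_function (\<lambda>x. orth (map (\<lambda>i. a i x) xs) (a i x))" by auto
  then show ?case
    unfolding list.map orth.simps
    by (intro polynomial_function_diff polynomial_function_mult
        polynomial_function_inner'[unfolded real_polynomial_function_eq])
qed simp

lemma real_polynomial_function_orth_factor:
  fixes a :: "'i \<Rightarrow> 'a::real_normed_vector \<Rightarrow> 'b::euclidean_space"
  assumes "\<And>i. i \<in> set xs \<Longrightarrow> polynomial_function (a i)"
  shows "real_polynomial_function (\<lambda>x. orth_factor (map (\<lambda>i. a i x) xs))"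
  using assms
proof (induction xs)
  case (Cons i xs)
  have factor: "real_polynomial_function (\<lambda>x. orth_factor (map (\<lambda>i. a i x) xs))"
    by (rule Cons.IH) (simp add: Cons.prems)
  have proj: "polynomial_function (\<lambda>x. orth (map (\<lambda>i. a i x) xs) (a i x))"
    by (rule polynomial_function_orth[where a = a and xs = xs and y = "a i"]) (simp_all add: Cons.prems)
  show ?case
    unfolding list.map orth_factor.simps
    by (rule real_polynomial_function.intros(4)[OF factor polynomial_function_inner'[OF proj proj]])
qed (simp add: real_polynomial_function.intros(2))

text \<open>A linearly moving vector is projected onto the orthogonal complement of the
  \<open>a i t\<close>. Orthogonality then holds at every \<open>t\<close>, even where these vectors
  become dependent; independence at 0 and 1 is what lets the curve hit the prescribed ends.\<close>

lemma orthogonal_polynomial_curve: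
  fixes a :: "'i \<Rightarrow> real \<Rightarrow> 'b::euclidean_space"
  assumes "finite T" and a: "\<And>i. i \<in> T \<Longrightarrow> polynomial_function (a i)"
    and S: "subspace S" "\<And>i t. i \<in> T \<Longrightarrow> a i t \<in> S"
    and x: "x0 \<in> S" "x1 \<in> S"
    and ind0: "\<And>\<kappa>. (\<Sum>i\<in>T. \<kappa> i *\<^sub>R a i 0) = 0 \<Longrightarrow> \<forall>i\<in>T. \<kappa> i = 0"
    and ind1: "\<And>\<kappa>. (\<Sum>i\<in>T. \<kappa> i *\<^sub>R a i 1) = 0 \<Longrightarrow> \<forall>i\<in>T. \<kappa> i = 0"
    and orth0: "\<And>i. i \<in> T \<Longrightarrow> x0 \<bullet> a i 0 = 0" and orth1: "\<And>i. i \<in> T \<Longrightarrow> x1 \<bullet> a i 1 = 0"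
  obtains x where "polynomial_function x" "x 0 = x0" "x 1 = x1" "\<And>t. x t \<in> S"
    "\<And>i t. i \<in> T \<Longrightarrow> x t \<bullet> a i t = 0"
proof -
  obtain xs where xs: "set xs = T" "distinct xs"
    using finite_distinct_list \<open>finite T\<close> by blast
  define c where "c t = orth_factor (map (\<lambda>i. a i t) xs)" for t
  have "c 0 \<noteq> 0"
    unfolding c_def by (rule orth_factor_nonzero[OF xs(2)]) (use ind0 xs(1) in blast)
  moreover have "c 1 \<noteq> 0"
    unfolding c_def by (rule orth_factor_nonzero[OF xs(2)]) (use ind1 xs(1) in blast)
  ultimately have c: "c 0 \<noteq> 0" "c 1 \<noteq> 0" by auto
  \<comment> \<open>At the ends \<open>orth\<close> multiplies \<open>x0\<close> and
    \<open>x1\<close> by \<open>c 0\<close> and \<open>c 1\<close>; dividing beforehand cancels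
    these factors.\<close>
  define u where "u t = ((1 - t) / c 0) *\<^sub>R x0 + (t / c 1) *\<^sub>R x1" for t
  define x where "x t = orth (map (\<lambda>i. a i t) xs) (u t)" for t
  have "polynomial_function u"
    unfolding u_def
    by (intro polynomial_function_add polynomial_function_mult polynomial_function_const)
      (simp_all add: diff_divide_distrib real_polynomial_function_eq[symmetric] real_polynomial_function_diff
        real_polynomial_function_divide real_polynomial_function.intros(1,2))
  then have "polynomial_function x"
    unfolding x_def using a xs by (intro polynomial_function_orth) auto
  moreover have "x 0 = x0"
    unfolding x_def by (subst orth_eq_factor) (use c orth0 xs in \<open>auto simp: u_def c_def\<close>)
  moreover have "x 1 = x1"
    unfolding x_def by (subst orth_eq_factor) (use c orth1 xs in \<open>auto simp: u_def c_def\<close>)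
  moreover have "x t \<in> S" for t
    unfolding x_def u_def using S xs x
    by (intro orth_mem_subspace subspace_add subspace_scale) auto
  moreover have "x t \<bullet> a i t = 0" if "i \<in> T" for i t
    unfolding x_def using that xs by (intro orth_orthogonal) auto
  ultimately show ?thesis using that by blast
qed

section \<open>Kernels and ranks of square matrices\<close>

lemma det_nonzero_iff_ker:
  fixes A :: "real^'n^'n"
  shows "det A \<noteq> 0 \<longleftrightarrow> (\<forall>x. A *v x = 0 \<longrightarrow> x = 0)"
  by (metis invertible_det_nz invertible_left_inverse matrix_left_invertible_ker)

lemma symmetric_inner:
  fixes A :: "real^'n^'n"
  assumes "transpose A = A"
  shows "(A *v x) \<bullet> y = x \<bullet> (A *v y)"
  by (metis assms dot_lmul_matrix transpose_matrix_vector)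

text \<open>By symmetry the kernel is the orthogonal complement of the range.\<close>

lemma symmetric_rank_nullity:
  fixes A :: "real^'n^'n"
  assumes "transpose A = A"
  shows "dim {x. A *v x = 0} + rank A = CARD('n)"
proof -
  have "{x. A *v x = 0} = {y \<in> UNIV. \<forall>x\<in>range ((*v) A). orthogonal x y}"
  proof (intro equalityI subsetI)
    fix y assume "y \<in> {y \<in> UNIV. \<forall>x\<in>range ((*v) A). orthogonal x y}"
    then have "\<forall>x. (A *v x) \<bullet> y = 0" by (auto simp: orthogonal_def)
    then have "\<forall>x. x \<bullet> (A *v y) = 0" by (simp add: symmetric_inner[OF assms])
    then have "A *v y = 0" by (metis inner_eq_zero_iff)
    then show "y \<in> {x. A *v x = 0}" by simp
  qed (auto simp: orthogonal_def symmetric_inner[OF assms])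
  moreover have "subspace (range ((*v) A))"
    by (simp add: linear_subspace_image)
  ultimately show ?thesis
    using dim_subspace_orthogonal_to_vectors[of "range ((*v) A)" UNIV]
    by (simp add: rank_dim_range)
qed

section \<open>Symmetric dependencies of vectors in general position\<close>

text \<open>Padding with the identity on \<open>C\<close> keeps the matrix type, while the
  determinant is the principal minor of \<open>A\<close> on the complement of
  \<open>C\<close>.\<close>

definition block :: "'n set \<Rightarrow> real^'n^'n \<Rightarrow> real^'n^'n" where
  "block C A = (\<chi> i j. if i \<notin> C \<and> j \<notin> C then A $ i $ j else if i = j then 1 else 0)"

lemma block_mult:
  fixes A :: "real^'n::finite^'n"
  shows "(block C A *v x) $ i = (if i \<in> C then x $ i else \<Sum>j\<in>-C. A $ i $ j * x $ j)"
proof (cases "i \<in> C")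
  case True
  then have "(block C A *v x) $ i = (\<Sum>j\<in>UNIV. if j = i then x $ j else 0)"
    unfolding matrix_vector_mult_def block_def vec_lambda_beta by (intro sum.cong refl) simp
  with True show ?thesis by simp
next
  case False
  then have "(block C A *v x) $ i = (\<Sum>j\<in>UNIV. if j \<in> -C then A $ i $ j * x $ j else 0)"
    unfolding matrix_vector_mult_def block_def vec_lambda_beta
    by (intro sum.cong refl) (use False in auto)
  with False show ?thesis by (simp add: sum.If_cases Compl_eq)
qed

lemma block_mult_supported:
  fixes A :: "real^'n::finite^'n"
  assumes "\<And>j. j \<in> C \<Longrightarrow> x $ j = 0" "i \<notin> C"
  shows "(block C A *v x) $ i = (A *v x) $ i"
proof -
  have "(A *v x) $ i = (\<Sum>j\<in>-C. A $ i $ j * x $ j)"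
    unfolding matrix_vector_mult_def using assms(1)
    by (simp, intro sum.mono_neutral_right) auto
  with assms(2) show ?thesis by (simp add: block_mult)
qed

lemma card_complement: "card (- T) = CARD('a) - card T" for T :: "'a::finite set"
  by (simp add: Compl_eq_Diff_UNIV card_Diff_subset)

text \<open>The vectors \<open>P i\<close> are the homogeneous coordinates of the points, so \<open>CARD('k) = d + 1\<close>, and
  \<open>spanning\<close> is affine general position.\<close>

locale spanning_vectors =
  fixes P :: "'n::finite \<Rightarrow> real^'k::finite"
  assumes spanning: "card S = CARD('k) \<Longrightarrow> (\<And>i. i \<in> S \<Longrightarrow> y \<bullet> P i = 0) \<Longrightarrow> y = 0"
    and card_le: "CARD('k) \<le> CARD('n)"
begin

text \<open>For homogeneous coordinates these are the values of affine functions at the points, that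
  is, the vectors that every stress matrix annihilates.\<close>

definition evaluation :: "real^'k \<Rightarrow> real^'n" where
  "evaluation y = (\<chi> i. y \<bullet> P i)"

lemma linear_evaluation: "linear evaluation"
  by (rule linearI) (simp_all add: evaluation_def vec_eq_iff inner_add_left)

lemma zero_on_large:
  assumes "CARD('k) \<le> card S" "\<And>i. i \<in> S \<Longrightarrow> y \<bullet> P i = 0"
  shows "y = 0"
  by (meson assms obtain_subset_with_card_n spanning subsetD)

lemma inj_evaluation: "inj evaluation"
  unfolding linear_injective_0[OF linear_evaluation]
  using zero_on_large[of UNIV] card_le by (auto simp: evaluation_def vec_eq_iff)

text \<open>Evaluation on \<open>C\<close> is injective by \<open>spanning\<close>, and source and
  target have the same dimension.\<close>

lemma interpolation:
  assumes "card C = CARD('k)"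
  obtains y where "\<And>i. i \<in> C \<Longrightarrow> y \<bullet> P i = z i"
proof -
  let ?V = "{x :: real^'n. \<forall>i. i \<notin> C \<longrightarrow> x $ i = 0}"
  let ?f = "\<lambda>y. \<chi> i. if i \<in> C then y \<bullet> P i else 0"
  have lin: "linear ?f"
    by (rule linearI) (simp_all add: vec_eq_iff inner_add_left)
  have "inj ?f"
    unfolding linear_injective_0[OF lin]
    using spanning[OF assms] by (auto simp: vec_eq_iff)
  then have "dim (range ?f) = CARD('k)"
    using dim_image_eq[OF lin, of UNIV] by simp
  moreover have "dim ?V = CARD('k)"
    using dim_substandard_cart[of C, where 'a=real] assms by (simp add: dim_vec_eq)
  moreover have "subspace (range ?f)" "subspace ?V"
    by (rule linear_subspace_image[OF lin subspace_UNIV]) (simp add: subspace_def)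
  moreover have "range ?f \<subseteq> ?V" by auto
  ultimately have "range ?f = ?V" by (intro subspace_dim_equal) auto
  moreover have "(\<chi> i. if i \<in> C then z i else 0) \<in> ?V" by auto
  ultimately obtain y where "?f y = (\<chi> i. if i \<in> C then z i else 0)"
    by (metis (no_types, lifting) imageE)
  then have "y \<bullet> P i = z i" if "i \<in> C" for i
    using that by (simp add: vec_eq_iff) metis
  then show ?thesis by (rule that)
qed

end

locale dependency = spanning_vectors P
  for P :: "'n::finite \<Rightarrow> real^'k::finite" +
  fixes \<Omega> :: "real^'n^'n"
  assumes symmetric: "transpose \<Omega> = \<Omega>"
    and equilibrium: "(\<Sum>j\<in>UNIV. \<Omega> $ i $ j *\<^sub>R P j) = 0"
begin

lemma entry_symmetric: "\<Omega> $ i $ j = \<Omega> $ j $ i"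
  by (metis symmetric transpose_def vec_lambda_beta)

lemma evaluation_ker: "\<Omega> *v evaluation y = 0"
proof -
  have "(\<Omega> *v evaluation y) $ i = y \<bullet> (\<Sum>j\<in>UNIV. \<Omega> $ i $ j *\<^sub>R P j)" for i
    by (simp add: matrix_vector_mult_def evaluation_def inner_sum_right)
  then show ?thesis by (simp add: equilibrium vec_eq_iff)
qed

text \<open>By symmetry \<open>\<Omega> *v x\<close> is orthogonal to all evaluations. One of them
  agrees with it on \<open>C\<close>, and off \<open>C\<close> it vanishes, so it is orthogonal to
  itself.\<close>

lemma mult_eq_0I:
  assumes C: "card C = CARD('k)" and x: "\<And>i. i \<notin> C \<Longrightarrow> (\<Omega> *v x) $ i = 0"
  shows "\<Omega> *v x = 0"
proof -
  obtain y where y: "\<And>i. i \<in> C \<Longrightarrow> y \<bullet> P i = (\<Omega> *v x) $ i"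
    using interpolation[OF C, of "\<lambda>i. (\<Omega> *v x) $ i"] by blast
  have "(\<Omega> *v x) \<bullet> (\<Omega> *v x) = (\<Omega> *v x) \<bullet> evaluation y"
    unfolding inner_vec_def
  proof (intro sum.cong refl)
    fix i
    show "(\<Omega> *v x) $ i \<bullet> (\<Omega> *v x) $ i = (\<Omega> *v x) $ i \<bullet> evaluation y $ i"
      by (cases "i \<in> C") (simp_all add: x y evaluation_def)
  qed
  also have "\<dots> = 0" by (simp add: symmetric_inner[OF symmetric] evaluation_ker)
  finally show ?thesis by simp
qed

lemma dim_range_evaluation: "dim (range evaluation) = CARD('k)"
  using dim_image_eq[OF linear_evaluation, of UNIV] inj_evaluation by simp

text \<open>The kernel always contains the evaluations, a space of dimension
  \<open>CARD('k)\<close>; maximal rank means that it contains nothing else.\<close>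

lemma rank_iff_ker:
  "rank \<Omega> + CARD('k) = CARD('n) \<longleftrightarrow> (\<forall>x. \<Omega> *v x = 0 \<longrightarrow> x \<in> range evaluation)"
proof -
  have sub: "subspace (range evaluation)" "subspace {x. \<Omega> *v x = 0}" "range evaluation \<subseteq> {x. \<Omega> *v x = 0}"
    using linear_subspace_image[OF linear_evaluation] linear_subspace_kernel[of "(*v) \<Omega>"]
    by (auto simp: evaluation_ker)
  have "rank \<Omega> + CARD('k) = CARD('n) \<longleftrightarrow> dim {x. \<Omega> *v x = 0} = dim (range evaluation)"
    using symmetric_rank_nullity[OF symmetric] by (auto simp: dim_range_evaluation)
  also have "\<dots> \<longleftrightarrow> {x. \<Omega> *v x = 0} = range evaluation"
    using subspace_dim_equal[OF sub] by (metis order_refl)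
  finally show ?thesis using sub(3) by blast
qed

text \<open>A kernel vector is an evaluation, and one that vanishes at \<open>CARD('k)\<close> or
  more indices is zero.\<close>

lemma ker_supported:
  assumes "rank \<Omega> + CARD('k) = CARD('n)" "card T + CARD('k) \<le> CARD('n)"
    and "\<And>i. i \<notin> T \<Longrightarrow> x $ i = 0" "\<Omega> *v x = 0"
  shows "x = 0"
proof -
  obtain y where y: "x = evaluation y" using assms rank_iff_ker by blast
  have "CARD('k) \<le> card (- T)" using assms(2) by (simp add: card_complement)
  then have "y = 0"
    using assms(3) y by (intro zero_on_large[of "- T"]) (auto simp: evaluation_def)
  with y show ?thesis by (simp add: evaluation_def vec_eq_iff)
qed

text \<open>This turns the rank condition into the nonvanishing of a single minor, with the same
  \<open>C\<close> for all matrices. Modulo evaluations, a kernel vector can be made zero on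
  \<open>C\<close>, where \<open>\<Omega>\<close> and its block act alike.\<close>

lemma rank_iff_det_block:
  assumes C: "card C = CARD('k)"
  shows "rank \<Omega> + CARD('k) = CARD('n) \<longleftrightarrow> det (block C \<Omega>) \<noteq> 0"
proof
  assume rk: "rank \<Omega> + CARD('k) = CARD('n)"
  have "x = 0" if "block C \<Omega> *v x = 0" for x
  proof -
    have x: "x $ i = 0" if "i \<in> C" for i
      using \<open>block C \<Omega> *v x = 0\<close> block_mult[of C \<Omega> x i] that by simp
    then have "(\<Omega> *v x) $ i = 0" if "i \<notin> C" for i
      using \<open>block C \<Omega> *v x = 0\<close> block_mult_supported[of C x i \<Omega>] that by simp
    then have "\<Omega> *v x = 0" by (rule mult_eq_0I[OF C])
    then show "x = 0"
      by (rule ker_supported[OF rk, of "- C", rotated 2])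
        (use x C card_le in \<open>auto simp: card_complement\<close>)
  qed
  then show "det (block C \<Omega>) \<noteq> 0" by (simp add: det_nonzero_iff_ker)
next
  assume det: "det (block C \<Omega>) \<noteq> 0"
  have "x \<in> range evaluation" if x: "\<Omega> *v x = 0" for x
  proof -
    obtain y where y: "\<And>i. i \<in> C \<Longrightarrow> y \<bullet> P i = x $ i"
      using interpolation[OF C, of "\<lambda>i. x $ i"] by blast
    let ?z = "x - evaluation y"
    have z: "?z $ i = 0" if "i \<in> C" for i using y[OF that] by (simp add: evaluation_def)
    have "\<Omega> *v ?z = 0" using x evaluation_ker by (simp add: matrix_vector_mult_diff_distrib)
    then have "(block C \<Omega> *v ?z) $ i = 0" for i
      using z block_mult[of C \<Omega> ?z i] block_mult_supported[of C ?z i \<Omega>] by (cases "i \<in> C") auto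
    then have "block C \<Omega> *v ?z = 0" by (simp add: vec_eq_iff)
    with det have "?z = 0" unfolding det_nonzero_iff_ker by blast
    then show ?thesis by auto
  qed
  then show "rank \<Omega> + CARD('k) = CARD('n)" by (simp add: rank_iff_ker)
qed

text \<open>This bounds the number of nonneighbours of a vertex by \<open>n - d - 2\<close>.\<close>

lemma column_zeros_bound:
  assumes rk: "rank \<Omega> + CARD('k) = CARD('n)" and lt: "CARD('k) < CARD('n)"
    and T: "\<And>i. i \<in> T \<Longrightarrow> \<Omega> $ i $ j = 0"
  shows "card T + CARD('k) < CARD('n)"
proof (rule ccontr)
  assume "\<not> ?thesis"
  then have "card (- T) \<le> CARD('k)" by (simp add: card_complement)
  then obtain C where C: "- T \<subseteq> C" "card C = CARD('k)"
    using exists_subset_between[of "- T" "CARD('k)" UNIV] card_le by auto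
  have col: "(\<Omega> *v axis j 1) $ i = \<Omega> $ i $ j" for i
    by (simp add: matrix_vector_mul_component inner_axis)
  \<comment> \<open>With too many zeros, column \<open>j\<close> vanishes off the set
    \<open>C\<close>, hence everywhere. Then a unit vector lies in the kernel, against
    \<open>ker_supported\<close>.\<close>
  have "\<Omega> *v axis j 1 = 0"
    using C(1) T by (intro mult_eq_0I[OF C(2)]) (auto simp: col)
  then have "axis j (1::real) = 0"
    by (rule ker_supported[OF rk, of "{j}", rotated 2]) (use lt in \<open>auto simp: axis_def\<close>)
  then show False by (simp add: axis_eq_0_iff)
qed

text \<open>Every unit vector is changed by an evaluation so as to vanish on \<open>C\<close>. As
  \<open>\<Omega>\<close> does not see the change, the vectors \<open>v i\<close> have
  \<open>\<Omega>\<close> as their Gram matrix for the form given by the block, and their entries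
  record how the other \<open>P k\<close> depend on those in \<open>C\<close>.\<close>

lemma block_decomposition:
  assumes rk: "rank \<Omega> + CARD('k) = CARD('n)" and C: "card C = CARD('k)"
  obtains v :: "'n \<Rightarrow> real^'n" where
    "\<And>i. i \<notin> C \<Longrightarrow> v i = axis i 1"
    "\<And>i k. k \<in> C \<Longrightarrow> v i $ k = 0"
    "\<And>k. k \<notin> C \<Longrightarrow> P k = - (\<Sum>j\<in>C. v j $ k *\<^sub>R P j)"
    "\<And>i j. v i \<bullet> (block C \<Omega> *v v j) = \<Omega> $ i $ j"
    "\<And>T \<kappa>. card T + CARD('k) \<le> CARD('n) \<Longrightarrow> (\<Sum>i\<in>T. \<kappa> i *\<^sub>R (block C \<Omega> *v v i)) = 0 \<Longrightarrow> \<forall>i\<in>T. \<kappa> i = 0"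
proof -
  have "\<forall>j. \<exists>y. \<forall>i\<in>C. y \<bullet> P i = (if i = j then 1 else 0)"
  proof
    fix j
    obtain y where "\<And>i. i \<in> C \<Longrightarrow> y \<bullet> P i = (if i = j then 1 else 0)"
      using interpolation[OF C, of "\<lambda>i. if i = j then 1 else 0"] by blast
    then show "\<exists>y. \<forall>i\<in>C. y \<bullet> P i = (if i = j then 1 else 0)" by blast
  qed
  then obtain y where y: "\<And>i j. i \<in> C \<Longrightarrow> y j \<bullet> P i = (if i = j then 1 else 0)" by metis
  \<comment> \<open>The \<open>y j\<close> with \<open>j\<close> in \<open>C\<close> form the basis
    dual to the \<open>P i\<close> with \<open>i\<close> in \<open>C\<close>.\<close>
  define v where "v j = (if j \<in> C then axis j 1 - evaluation (y j) else axis j 1)" for j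
  have v0: "v i $ k = 0" if "k \<in> C" for i k
    using that y[of k i] by (auto simp: v_def evaluation_def axis_def)
  have col: "(\<Omega> *v axis j 1) $ i = \<Omega> $ i $ j" for i j
    by (simp add: matrix_vector_mul_component inner_axis)
  have \<Omega>v: "\<Omega> *v v j = \<Omega> *v axis j 1" for j
    by (simp add: v_def matrix_vector_mult_diff_distrib evaluation_ker)
  have bv: "(block C \<Omega> *v v j) $ i = (if i \<in> C then 0 else \<Omega> $ i $ j)" for i j
    using block_mult_supported[of C "v j" i \<Omega>] v0 by (auto simp: block_mult \<Omega>v col)
  have gram: "v i \<bullet> (block C \<Omega> *v v j) = \<Omega> $ i $ j" for i j
  proof -
    have "v i \<bullet> (block C \<Omega> *v v j) = v i \<bullet> (\<Omega> *v axis j 1)"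
      unfolding inner_vec_def using v0 by (intro sum.cong) (auto simp: bv col)
    also have "\<dots> = (\<Omega> *v v i) \<bullet> axis j 1" by (simp add: symmetric_inner[OF symmetric])
    also have "\<dots> = \<Omega> $ i $ j" by (simp add: \<Omega>v inner_axis col entry_symmetric)
    finally show ?thesis .
  qed
  have P: "P k = - (\<Sum>j\<in>C. v j $ k *\<^sub>R P j)" if "k \<notin> C" for k
  proof -
    have "z \<bullet> P k = z \<bullet> - (\<Sum>j\<in>C. v j $ k *\<^sub>R P j)" for z
    proof -
      \<comment> \<open>A functional is determined by its values on \<open>C\<close>, so
        \<open>z\<close> equals its expansion in the dual basis.\<close>
      have "z - (\<Sum>j\<in>C. (z \<bullet> P j) *\<^sub>R y j) = 0"
      proof (rule spanning[OF C])
        fix i assume "i \<in> C"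
        then show "(z - (\<Sum>j\<in>C. (z \<bullet> P j) *\<^sub>R y j)) \<bullet> P i = 0"
          by (simp add: inner_diff_left inner_sum_left y if_distrib[of "\<lambda>x. _ * x"] cong: if_cong)
      qed
      then have "z \<bullet> P k = (\<Sum>j\<in>C. (z \<bullet> P j) *\<^sub>R y j) \<bullet> P k" by simp
      also have "\<dots> = (\<Sum>j\<in>C. (z \<bullet> P j) * - (v j $ k))"
        using that by (auto simp: inner_sum_left v_def evaluation_def axis_def intro!: sum.cong)
      also have "\<dots> = z \<bullet> - (\<Sum>j\<in>C. v j $ k *\<^sub>R P j)"
        by (simp add: inner_sum_right sum_negf mult.commute)
      finally show ?thesis .
    qed
    then show ?thesis by (metis vector_eq_ldot)
  qed
  have ind: "\<forall>i\<in>T. \<kappa> i = 0"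
    if T: "card T + CARD('k) \<le> CARD('n)" and sum: "(\<Sum>i\<in>T. \<kappa> i *\<^sub>R (block C \<Omega> *v v i)) = 0" for T \<kappa>
  proof -
    \<comment> \<open>The coefficients form a vector supported on \<open>T\<close>. Off
      \<open>C\<close> its image under \<open>\<Omega>\<close> is the given combination, so it lies
      in the kernel, and its small support makes it zero.\<close>
    let ?x = "\<chi> i. if i \<in> T then \<kappa> i else 0"
    have "(\<Omega> *v ?x) $ k = 0" if "k \<notin> C" for k
    proof -
      have "(\<Omega> *v ?x) $ k = (\<Sum>i\<in>T. \<kappa> i * \<Omega> $ k $ i)"
        by (simp add: matrix_vector_mult_def if_distrib[of "\<lambda>x. _ * x"] sum.If_cases mult.commute cong: if_cong)
      also have "\<dots> = (\<Sum>i\<in>T. \<kappa> i *\<^sub>R (block C \<Omega> *v v i)) $ k"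
        using that by (simp add: bv)
      finally show ?thesis using sum by simp
    qed
    then have "\<Omega> *v ?x = 0" by (rule mult_eq_0I[OF C])
    then have "?x = 0" by (rule ker_supported[OF rk T, rotated]) auto
    then show ?thesis by (simp add: vec_eq_iff) metis
  qed
  show ?thesis
    by (rule that[of v]) (use v0 P gram ind in \<open>auto simp: v_def\<close>)
qed

end

section \<open>Frameworks in homogeneous coordinates\<close>

text \<open>The extra element \<open>None\<close> of the index type is the homogenizing
  coordinate.\<close>

definition homogenize :: "real^'d \<Rightarrow> real^'d option" where
  "homogenize x = (\<chi> k. case k of None \<Rightarrow> 1 | Some l \<Rightarrow> x $ l)"

lemma sum_option: "(\<Sum>k\<in>UNIV. f k) = f None + (\<Sum>l\<in>UNIV. f (Some l))"
  for f :: "'d::finite option \<Rightarrow> 'b::comm_monoid_add"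
  by (simp add: UNIV_option_conv sum.reindex)

lemma inner_homogenize:
  fixes x :: "real^'d::finite"
  shows "y \<bullet> homogenize x = y $ None + (\<chi> l. y $ Some l) \<bullet> x"
  by (simp add: inner_vec_def sum_option homogenize_def)

section \<open>General position and Gram determinants\<close>

lemma aff_dim_Un_image_le:
  fixes p :: "'i \<Rightarrow> 'a::euclidean_space"
  assumes "finite T"
  shows "aff_dim (A \<union> p ` T) \<le> aff_dim A + int (card T)"
  using assms
proof induction
  case (insert i T)
  have "aff_dim (insert (p i) (A \<union> p ` T)) \<le> aff_dim (A \<union> p ` T) + 1"
    by (simp add: aff_dim_insert)
  with insert show ?case by simp
qed simp

text \<open>A nonzero \<open>y\<close> orthogonal to the homogenized points describes a hyperplane
  through them. Conversely, a degenerate set of fewer than d + 1 indices is filled up with arbitrary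
  further vertices, each raising the affine dimension by at most one.\<close>

lemma affine_general_position_iff:
  fixes p :: "real^'d::finite^'n::finite"
  assumes n: "CARD('d option) \<le> CARD('n)"
  shows "affine_general_position p \<longleftrightarrow>
    (\<forall>S y. card S = CARD('d option) \<longrightarrow> (\<forall>i\<in>S. y \<bullet> homogenize (p $ i) = 0) \<longrightarrow> y = 0)"
proof (intro iffI allI impI)
  fix S and y :: "real^'d option"
  assume gp: "affine_general_position p" and S: "card S = CARD('d option)"
    and y: "\<forall>i\<in>S. y \<bullet> homogenize (p $ i) = 0"
  define a where "a = (\<chi> l. y $ Some l)"
  define A where "A = {x. a \<bullet> x = - y $ None}"
  have pA: "\<forall>i\<in>S. p $ i \<in> A"
    using y by (auto simp: A_def a_def inner_homogenize)
  have "a = 0"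
  proof (rule ccontr)
    assume "a \<noteq> 0"
    \<comment> \<open>A hyperplane has dimension d - 1, and here \<open>card S\<close> is d +
      1.\<close>
    then have "aff_dim A = int (card S) - 2"
      by (simp add: A_def aff_dim_hyperplane S card_option)
    moreover have "affine A" by (simp add: A_def affine_hyperplane)
    moreover have "card S \<le> CARD('d) + 1" using S by simp
    ultimately show False
      using gp pA unfolding affine_general_position_def by blast
  qed
  moreover have "S \<noteq> {}" using S by auto
  then obtain i where "i \<in> S" by blast
  ultimately have "y $ None = 0" using pA by (auto simp: A_def split: if_splits)
  moreover have "y $ Some l = 0" for l
    using \<open>a = 0\<close> by (simp add: a_def vec_eq_iff)
  ultimately have "y $ k = 0" for k by (cases k) auto
  then show "y = 0" by (simp add: vec_eq_iff)
next
  assume span: "\<forall>S y. card S = CARD('d option) \<longrightarrow> (\<forall>i\<in>S. y \<bullet> homogenize (p $ i) = 0) \<longrightarrow> y = 0"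
  show "affine_general_position p"
    unfolding affine_general_position_def
  proof (intro notI, elim exE conjE)
    fix S :: "'n set" and A
    assume S: "card S \<le> CARD('d) + 1" and "affine A" and A: "aff_dim A = int (card S) - 2"
      and pA: "\<forall>i\<in>S. p $ i \<in> A"
    obtain S' where S': "S \<subseteq> S'" "card S' = CARD('d option)"
      using exists_subset_between[of S "CARD('d option)" UNIV] S n by (auto simp: card_option)
    have "card (S' - S) = CARD('d) + 1 - card S"
      using S' by (simp add: card_Diff_subset card_option)
    then have "aff_dim (A \<union> (\<lambda>i. p $ i) ` (S' - S)) < DIM(real^'d)"
      using aff_dim_Un_image_le[of "S' - S" A "\<lambda>i. p $ i"] A S by simp
    then obtain a b where a: "a \<noteq> 0" and sub: "A \<union> (\<lambda>i. p $ i) ` (S' - S) \<subseteq> {x. a \<bullet> x = b}"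
      by (rule aff_lowdim_subset_hyperplane)
    define y where "y = (\<chi> k. case k of None \<Rightarrow> - b | Some l \<Rightarrow> a $ l)"
    have "y \<bullet> homogenize (p $ i) = 0" if "i \<in> S'" for i
    proof -
      have "p $ i \<in> A \<union> (\<lambda>i. p $ i) ` (S' - S)" using that pA by (cases "i \<in> S") auto
      then have "a \<bullet> p $ i = b" using sub by blast
      moreover have "(\<chi> l. a $ l) = a" by (simp add: vec_eq_iff)
      ultimately show ?thesis by (simp add: inner_homogenize y_def)
    qed
    then have "y = 0" using span S'(2) by blast
    then have "a $ l = 0" for l
      by (auto simp: y_def vec_eq_iff dest: spec[of _ "Some l"])
    then show False using a by (simp add: vec_eq_iff)
  qed
qed

text \<open>The sum of the outer products of the \<open>P i\<close> with themselves. It tests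
  whether they span without arranging \<open>S\<close> as the columns of a square matrix.\<close>

definition gram :: "'n set \<Rightarrow> ('n \<Rightarrow> real^'k) \<Rightarrow> real^'k^'k" where
  "gram S P = (\<chi> k l. \<Sum>i\<in>S. P i $ k * P i $ l)"

lemma gram_mult:
  fixes P :: "'n::finite \<Rightarrow> real^'k::finite"
  shows "gram S P *v y = (\<Sum>i\<in>S. (y \<bullet> P i) *\<^sub>R P i)"
proof -
  have "(gram S P *v y) $ k = (\<Sum>i\<in>S. (y \<bullet> P i) *\<^sub>R P i) $ k" for k
  proof -
    have "(gram S P *v y) $ k = (\<Sum>l\<in>UNIV. \<Sum>i\<in>S. y $ l * P i $ l * P i $ k)"
      by (simp add: gram_def matrix_vector_mult_def sum_distrib_left mult_ac)
    also have "\<dots> = (\<Sum>i\<in>S. \<Sum>l\<in>UNIV. y $ l * P i $ l * P i $ k)"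
      by (rule sum.swap)
    also have "\<dots> = (\<Sum>i\<in>S. (y \<bullet> P i) *\<^sub>R P i) $ k"
      by (simp add: inner_vec_def sum_distrib_right)
    finally show ?thesis .
  qed
  then show ?thesis by (simp add: vec_eq_iff)
qed

text \<open>Over the reals the quadratic form of \<open>gram S P\<close> is a sum of squares, so its
  kernel consists of the common orthogonal vectors.\<close>

lemma det_gram_nonzero_iff:
  fixes P :: "'n::finite \<Rightarrow> real^'k::finite"
  shows "det (gram S P) \<noteq> 0 \<longleftrightarrow> (\<forall>y. (\<forall>i\<in>S. y \<bullet> P i = 0) \<longrightarrow> y = 0)"
proof -
  have "gram S P *v y = 0 \<longleftrightarrow> (\<forall>i\<in>S. y \<bullet> P i = 0)" for y
  proof
    assume "gram S P *v y = 0"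
    then have "y \<bullet> (\<Sum>i\<in>S. (y \<bullet> P i) *\<^sub>R P i) = 0" by (simp add: gram_mult)
    then have "(\<Sum>i\<in>S. (y \<bullet> P i) * (y \<bullet> P i)) = 0" by (simp add: inner_sum_right)
    then show "\<forall>i\<in>S. y \<bullet> P i = 0" by (subst (asm) sum_nonneg_eq_0_iff) auto
  qed (simp add: gram_mult)
  then show ?thesis by (simp add: det_nonzero_iff_ker)
qed

text \<open>As a product of Gram determinants it turns general position into the nonvanishing of one
  polynomial.\<close>

definition position_polynomial :: "('n \<Rightarrow> real^'k) \<Rightarrow> real" where
  "position_polynomial P = (\<Prod>S\<in>{S. card S = CARD('k)}. det (gram S P))"

lemma position_polynomial_nonzero_iff:
  fixes P :: "'n::finite \<Rightarrow> real^'k::finite"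
  shows "position_polynomial P \<noteq> 0 \<longleftrightarrow>
    (\<forall>S y. card S = CARD('k) \<longrightarrow> (\<forall>i\<in>S. y \<bullet> P i = 0) \<longrightarrow> y = 0)"
proof -
  have "position_polynomial P \<noteq> 0 \<longleftrightarrow> (\<forall>S. card S = CARD('k) \<longrightarrow> det (gram S P) \<noteq> 0)"
    unfolding position_polynomial_def by auto
  then show ?thesis unfolding det_gram_nonzero_iff by blast
qed

lemma position_polynomial_scale:
  fixes P :: "'n::finite \<Rightarrow> real^'k::finite"
  assumes "position_polynomial P \<noteq> 0" "\<And>i. h i \<noteq> 0"
  shows "position_polynomial (\<lambda>i. h i *\<^sub>R P i) \<noteq> 0"
  using assms unfolding position_polynomial_nonzero_iff by simp

lemma real_polynomial_function_position:
  fixes P :: "'n::finite \<Rightarrow> 'a::real_normed_vector \<Rightarrow> real^'k::finite"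
  assumes "\<And>i. polynomial_function (P i)"
  shows "real_polynomial_function (\<lambda>x. position_polynomial (\<lambda>i. P i x))"
proof -
  have "real_polynomial_function (\<lambda>x. gram S (\<lambda>i. P i x) $ k $ l)" for S k l
    unfolding gram_def vec_lambda_beta
    by (intro real_polynomial_function_sum real_polynomial_function.intros(4)
        real_polynomial_function_vec_nth assms finite)
  then show ?thesis
    unfolding position_polynomial_def
    by (intro real_polynomial_function_prod real_polynomial_function_det finite)
qed

section \<open>Stress matrices as symmetric dependencies\<close>

lemma homogenize_equilibrium_iff:
  fixes p :: "real^'d::finite^'n::finite" and \<Omega> :: "real^'n^'n"
  shows "(\<forall>i. (\<Sum>j\<in>UNIV. \<Omega> $ i $ j *\<^sub>R homogenize (p $ j)) = 0) \<longleftrightarrow>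
    \<Omega> *v 1 = 0 \<and> (\<forall>i. (\<Sum>j\<in>UNIV. (\<Omega> $ i $ j) *\<^sub>R (p $ j)) = 0)"
proof -
  have "(\<Sum>j\<in>UNIV. \<Omega> $ i $ j *\<^sub>R homogenize (p $ j)) = 0 \<longleftrightarrow>
      (\<Omega> *v 1) $ i = 0 \<and> (\<Sum>j\<in>UNIV. (\<Omega> $ i $ j) *\<^sub>R (p $ j)) = 0" for i
    \<comment> \<open>Coordinate \<open>None\<close> gives the condition on the all-ones vector, the
      other coordinates give equilibrium.\<close>
    unfolding vec_eq_iff split_option_all
    by (simp add: homogenize_def matrix_vector_mult_def)
  then show ?thesis by (auto simp: vec_eq_iff)
qed

lemma Gstressable_iff_dependency:
  fixes p :: "real^'d::finite^'n::finite"
  assumes n: "CARD('d option) \<le> CARD('n)"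
  shows "Gstressable E p \<longleftrightarrow> (\<exists>\<Omega>. dependency (\<lambda>i. homogenize (p $ i)) \<Omega> \<and>
    (\<forall>i j. i \<noteq> j \<and> {i, j} \<notin> E \<longrightarrow> \<Omega> $ i $ j = 0) \<and> rank \<Omega> + CARD('d option) = CARD('n))"
proof -
  have "dependency (\<lambda>i. homogenize (p $ i)) \<Omega> \<longleftrightarrow>
      affine_general_position p \<and> transpose \<Omega> = \<Omega> \<and> \<Omega> *v 1 = 0 \<and>
      (\<forall>i. (\<Sum>j\<in>UNIV. (\<Omega> $ i $ j) *\<^sub>R (p $ j)) = 0)" for \<Omega>
    unfolding dependency_def dependency_axioms_def spanning_vectors_def
      homogenize_equilibrium_iff[symmetric] affine_general_position_iff[OF n]
    using n by blast
  then show ?thesis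
    unfolding Gstressable_def equilibrium_stress_matrix_def
    by (auto simp: card_option add.assoc)
qed

lemma dependency_iff:
  fixes P :: "'n::finite \<Rightarrow> real^'k::finite"
  assumes "CARD('k) \<le> CARD('n)"
  shows "dependency P \<Omega> \<longleftrightarrow> position_polynomial P \<noteq> 0 \<and> transpose \<Omega> = \<Omega> \<and>
    (\<forall>i. (\<Sum>j\<in>UNIV. \<Omega> $ i $ j *\<^sub>R P j) = 0)"
  unfolding dependency_def dependency_axioms_def spanning_vectors_def position_polynomial_nonzero_iff
  using assms by blast

text \<open>For fixed \<open>p\<close> in general position, what remains is a system of linear
  equations in \<open>\<Omega>\<close> and one polynomial inequation.\<close>

lemma Gstressable_iff_block:
  fixes p :: "real^'d::finite^'n::finite"
  assumes n: "CARD('d option) \<le> CARD('n)" and C: "card C = CARD('d option)"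
  shows "Gstressable E p \<longleftrightarrow> position_polynomial (\<lambda>i. homogenize (p $ i)) \<noteq> 0 \<and>
    (\<exists>\<Omega>. transpose \<Omega> = \<Omega> \<and> (\<forall>i j. i \<noteq> j \<and> {i, j} \<notin> E \<longrightarrow> \<Omega> $ i $ j = 0) \<and>
      (\<forall>i. (\<Sum>j\<in>UNIV. \<Omega> $ i $ j *\<^sub>R homogenize (p $ j)) = 0) \<and> det (block C \<Omega>) \<noteq> 0)"
proof -
  let ?P = "\<lambda>i. homogenize (p $ i)"
  have "(dependency ?P \<Omega> \<and> (\<forall>i j. i \<noteq> j \<and> {i, j} \<notin> E \<longrightarrow> \<Omega> $ i $ j = 0) \<and>
        rank \<Omega> + CARD('d option) = CARD('n)) \<longleftrightarrow>
      (dependency ?P \<Omega> \<and> (\<forall>i j. i \<noteq> j \<and> {i, j} \<notin> E \<longrightarrow> \<Omega> $ i $ j = 0) \<and> det (block C \<Omega>) \<noteq> 0)" for \<Omega>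
    by (intro conj_cong refl) (rule dependency.rank_iff_det_block[OF _ C])
  then have eq: "Gstressable E p \<longleftrightarrow> (\<exists>\<Omega>. dependency ?P \<Omega> \<and>
    (\<forall>i j. i \<noteq> j \<and> {i, j} \<notin> E \<longrightarrow> \<Omega> $ i $ j = 0) \<and> det (block C \<Omega>) \<noteq> 0)"
    unfolding Gstressable_iff_dependency[OF n] by (rule arg_cong[where f = Ex, OF ext])
  show ?thesis
    unfolding eq dependency_iff[OF n] by (rule iffI; elim exE conjE; intro conjI exI; assumption)
qed

section \<open>Constructibility\<close>

text \<open>Where the vectors listed by \<open>xs\<close> are independent and span all
  \<open>a i p\<close>, the operator \<open>R xs p\<close> maps onto the solution space. Existence
  of a solution \<open>x\<close> becomes existence of a free parameter \<open>y\<close>, whose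
  negation is a system of polynomial equations in \<open>p\<close>.\<close>

lemma constructible_linear_projection:
  fixes a :: "'i::finite \<Rightarrow> 'a::euclidean_space \<Rightarrow> 'b::euclidean_space"
  assumes a: "\<And>i. polynomial_function (a i)"
    and G: "real_polynomial_function G" and g: "real_polynomial_function g"
  shows "constructible {p. G p \<noteq> 0 \<and> (\<exists>x. (\<forall>i. x \<bullet> a i p = 0) \<and> g x \<noteq> 0)}"
proof -
  define c where "c xs p = orth_factor (map (\<lambda>i. a i p) xs)" for xs p
  define R where "R xs p = orth (map (\<lambda>i. a i p) xs)" for xs p
  have c: "real_polynomial_function (c xs)" for xs
    unfolding c_def using a by (rule real_polynomial_function_orth_factor)
  have R: "polynomial_function (\<lambda>p. R xs p (y p))" if "polynomial_function y" for xs y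
    unfolding R_def using a that by (intro polynomial_function_orth)
  \<comment> \<open>A vanishing squared length says that the projection kills
    \<open>a i p\<close>.\<close>
  define A where "A xs = {p. \<forall>f\<in>range (\<lambda>i p. R xs p (a i p) \<bullet> R xs p (a i p)). f p = 0}" for xs
  \<comment> \<open>One equation for every parameter \<open>y\<close>; the basis theorem reduces
    this infinite family to a finite one.\<close>
  define B where "B xs = {p. \<forall>f\<in>range (\<lambda>y p. G p * c xs p * g (R xs p y)). f p = 0}" for xs
  have "algebraic_set (A xs)" for xs
    unfolding A_def using R[OF a] by (intro algebraic_set_zeros) (auto intro: polynomial_function_inner')
  moreover have "algebraic_set (B xs)" for xs
  proof -
    have "real_polynomial_function (\<lambda>p. g (R xs p y))" for y
      using real_polynomial_function_compose[OF R[OF polynomial_function_const] g, of xs y]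
      by (simp add: o_def)
    then show ?thesis
      unfolding B_def using G c
      by (intro algebraic_set_zeros) (auto intro!: real_polynomial_function.intros(4))
  qed
  ultimately have qp: "quasi_projective (A xs - B xs)" for xs
    unfolding quasi_projective_def by blast
  let ?L = "{xs :: 'i list. set xs \<subseteq> UNIV \<and> length xs \<le> CARD('i)}"
  have fin: "finite ?L" by (rule finite_lists_length_le) simp
  have "{p. G p \<noteq> 0 \<and> (\<exists>x. (\<forall>i. x \<bullet> a i p = 0) \<and> g x \<noteq> 0)} = (\<Union>xs\<in>?L. A xs - B xs)"
  proof (intro equalityI subsetI)
    fix p assume "p \<in> {p. G p \<noteq> 0 \<and> (\<exists>x. (\<forall>i. x \<bullet> a i p = 0) \<and> g x \<noteq> 0)}"
    then obtain x where Gp: "G p \<noteq> 0" and x: "\<And>i. x \<bullet> a i p = 0" "g x \<noteq> 0" by auto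
    have len: "length xs \<le> CARD('i)" if "distinct xs" for xs :: "'i list"
      using that by (metis card_mono distinct_card finite subset_UNIV)
    \<comment> \<open>A longest list with nonzero factor exists, since the empty list has factor 1
      and distinct lists have bounded length.\<close>
    obtain xs where xs: "distinct xs" "c xs p \<noteq> 0"
      and max: "\<And>ys. distinct ys \<Longrightarrow> c ys p \<noteq> 0 \<Longrightarrow> length ys \<le> length xs"
      using ex_has_greatest_nat[of "\<lambda>xs. distinct xs \<and> c xs p \<noteq> 0" "[]" length "Suc CARD('i)"] len
      by (auto simp: c_def le_imp_less_Suc)
    have "R xs p (a i p) = 0" for i
    proof (cases "i \<in> set xs")
      case True
      let ?z = "R xs p (a i p)"
      have perp: "?z \<bullet> b = 0" if "b \<in> set (map (\<lambda>i. a i p) xs)" for b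
        using that unfolding R_def by (rule orth_orthogonal)
      have "?z \<bullet> ?z = a i p \<bullet> R xs p ?z"
        unfolding R_def by (rule orth_selfadjoint)
      also have "R xs p ?z = c xs p *\<^sub>R ?z"
        using orth_eq_factor[OF perp] unfolding R_def c_def by blast
      also have "a i p \<bullet> c xs p *\<^sub>R ?z = 0"
        using perp[of "a i p"] True by (simp add: inner_commute)
      finally show ?thesis by simp
    next
      case False
      then have "c (i # xs) p = 0" using max[of "i # xs"] xs by auto
      then show ?thesis using xs(2) by (simp add: c_def R_def)
    qed
    then have "p \<in> A xs" by (simp add: A_def)
    moreover have "R xs p (x /\<^sub>R c xs p) = x"
      using orth_eq_factor[of "map (\<lambda>i. a i p) xs" "x /\<^sub>R c xs p"] x(1) xs(2)
      by (auto simp: R_def c_def)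
    then have "p \<notin> B xs"
      using Gp x(2) xs(2) unfolding B_def by (auto intro!: exI[of _ "x /\<^sub>R c xs p"])
    ultimately show "p \<in> (\<Union>xs\<in>?L. A xs - B xs)" using len[OF xs(1)] by blast
  next
    fix p assume "p \<in> (\<Union>xs\<in>?L. A xs - B xs)"
    then obtain xs where xs: "p \<in> A xs" "p \<notin> B xs" by blast
    from xs(2) obtain y where y: "G p \<noteq> 0" "g (R xs p y) \<noteq> 0" by (auto simp: B_def)
    have "R xs p y \<bullet> a i p = 0" for i
      using xs(1) orth_selfadjoint[of "map (\<lambda>i. a i p) xs" y "a i p"] by (simp add: A_def R_def)
    with y show "p \<in> {p. G p \<noteq> 0 \<and> (\<exists>x. (\<forall>i. x \<bullet> a i p = 0) \<and> g x \<noteq> 0)}" by blast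
  qed
  then show ?thesis
    unfolding constructible_def using fin qp by (intro exI[of _ "(\<lambda>xs. A xs - B xs) ` ?L"]) auto
qed

text \<open>A linear map from all matrices onto the symmetric ones with the zero pattern of the
  graph; it removes symmetry and sparsity from the constraints.\<close>

definition symmetric_part :: "'n set set \<Rightarrow> real^'n^'n \<Rightarrow> real^'n^'n" where
  "symmetric_part E B = (\<chi> i j. if i = j \<or> {i, j} \<in> E then B $ i $ j + B $ j $ i else 0)"

lemma polynomial_function_homogenize:
  fixes p :: "'a::real_normed_vector \<Rightarrow> real^'d::finite"
  assumes "polynomial_function p"
  shows "polynomial_function (\<lambda>x. homogenize (p x))"
proof (rule polynomial_function_vec)
  fix k :: "'d option"
  show "polynomial_function (\<lambda>x. homogenize (p x) $ k)"
    using polynomial_function_vec_nth[OF assms] by (cases k) (simp_all add: homogenize_def)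
qed

lemma constructible_Gstressable:
  assumes n: "CARD('d::finite option) \<le> CARD('n::finite)"
  shows "constructible {p :: real^'d^'n. Gstressable E p}"
proof -
  obtain C :: "'n set" where C: "card C = CARD('d option)"
    using obtain_subset_with_card_n[OF n] by metis
  define L where "L ik p B = (\<Sum>j\<in>UNIV. symmetric_part E B $ fst ik $ j * homogenize (p $ j) $ snd ik)"
    for ik :: "'n \<times> 'd option" and p :: "real^'d^'n" and B :: "real^'n^'n"
  \<comment> \<open>The vector that represents the linear functional \<open>L ik p\<close> through
    the inner product.\<close>
  define a where "a ik p = (\<Sum>b\<in>Basis. L ik p b *\<^sub>R b)" for ik p
  have lin: "linear (L ik p)" for ik p
  proof (rule linearI)
    fix B B' :: "real^'n^'n" and r :: real
    have "symmetric_part E (B + B') $ i $ j = symmetric_part E B $ i $ j + symmetric_part E B' $ i $ j"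
      "symmetric_part E (r *\<^sub>R B) $ i $ j = r * symmetric_part E B $ i $ j" for i j
      by (simp_all add: symmetric_part_def algebra_simps)
    then show "L ik p (B + B') = L ik p B + L ik p B'" "L ik p (r *\<^sub>R B) = r *\<^sub>R L ik p B"
      by (simp_all add: L_def distrib_right sum.distrib sum_distrib_left mult.assoc)
  qed
  have inner_a: "B \<bullet> a ik p = L ik p B" for B ik p
  proof -
    have "B \<bullet> a ik p = L ik p (\<Sum>b\<in>Basis. (B \<bullet> b) *\<^sub>R b)"
      by (simp add: a_def inner_sum_right linear_sum[OF lin] linear_cmul[OF lin] mult.commute)
    then show ?thesis by (simp add: euclidean_representation)
  qed
  have hom: "polynomial_function (\<lambda>p :: real^'d^'n. homogenize (p $ i))" for i
    by (intro polynomial_function_homogenize polynomial_function_vec_nth polynomial_function_id)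
  have "real_polynomial_function (\<lambda>p. L ik p B)" for ik B
    unfolding L_def using hom
    by (intro real_polynomial_function_sum real_polynomial_function.intros(4)
        real_polynomial_function.intros(2) real_polynomial_function_vec_nth finite)
  then have a: "polynomial_function (a ik)" for ik
    unfolding a_def[abs_def]
    by (intro polynomial_function_sum polynomial_function_mult polynomial_function_const)
      (simp_all add: real_polynomial_function_eq)
  have entry: "real_polynomial_function (\<lambda>B :: real^'n^'n. B $ i $ j)" for i j
    by (intro real_polynomial_function_vec_nth polynomial_function_vec_nth polynomial_function_id)
  have "real_polynomial_function (\<lambda>B. symmetric_part E B $ i $ j)" for i j
    unfolding symmetric_part_def vec_lambda_beta
    by (cases "i = j \<or> {i, j} \<in> E")
      (simp_all add: entry real_polynomial_function.intros(2,3))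
  then have "real_polynomial_function (\<lambda>B. block C (symmetric_part E B) $ i $ j)" for i j
    unfolding block_def vec_lambda_beta
    by (cases "i \<in> C"; cases "j \<in> C"; cases "i = j") (simp_all add: real_polynomial_function.intros(2))
  then have g: "real_polynomial_function (\<lambda>B. det (block C (symmetric_part E B)))"
    by (rule real_polynomial_function_det)
  have stressable: "Gstressable E p \<longleftrightarrow> position_polynomial (\<lambda>i. homogenize (p $ i)) \<noteq> 0 \<and>
    (\<exists>B. (\<forall>ik. B \<bullet> a ik p = 0) \<and> det (block C (symmetric_part E B)) \<noteq> 0)" for p :: "real^'d^'n"
  proof -
    have eq: "(\<forall>ik. B \<bullet> a ik p = 0) \<longleftrightarrow>
      (\<forall>i. (\<Sum>j\<in>UNIV. symmetric_part E B $ i $ j *\<^sub>R homogenize (p $ j)) = 0)" for B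
      by (simp add: inner_a L_def vec_eq_iff)
    have sym: "transpose (symmetric_part E B) = symmetric_part E B" for B
      by (auto simp: symmetric_part_def transpose_def vec_eq_iff insert_commute)
    have supp: "i \<noteq> j \<and> {i, j} \<notin> E \<longrightarrow> symmetric_part E B $ i $ j = 0" for B i j
      by (simp add: symmetric_part_def)
    \<comment> \<open>Surjectivity: \<open>symmetric_part\<close> adds the transpose and so doubles
      a matrix of the right shape.\<close>
    have half: "symmetric_part E ((1/2) *\<^sub>R \<Omega>) = \<Omega>"
      if "transpose \<Omega> = \<Omega>" "\<forall>i j. i \<noteq> j \<and> {i, j} \<notin> E \<longrightarrow> \<Omega> $ i $ j = 0" for \<Omega>
    proof -
      have "\<Omega> $ j $ i = \<Omega> $ i $ j" for i j
        using that(1) by (metis transpose_def vec_lambda_beta)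
      with that(2) show ?thesis by (simp add: symmetric_part_def vec_eq_iff)
    qed
    show ?thesis
      unfolding Gstressable_iff_block[OF n C] eq
    proof (rule conj_cong[OF refl], rule iffI; elim exE conjE)
      fix \<Omega>
      assume "transpose \<Omega> = \<Omega>" "\<forall>i j. i \<noteq> j \<and> {i, j} \<notin> E \<longrightarrow> \<Omega> $ i $ j = 0"
        "\<forall>i. (\<Sum>j\<in>UNIV. \<Omega> $ i $ j *\<^sub>R homogenize (p $ j)) = 0" "det (block C \<Omega>) \<noteq> 0"
      with half show "\<exists>B. (\<forall>i. (\<Sum>j\<in>UNIV. symmetric_part E B $ i $ j *\<^sub>R homogenize (p $ j)) = 0) \<and>
          det (block C (symmetric_part E B)) \<noteq> 0"
        by (intro exI[of _ "(1/2) *\<^sub>R \<Omega>"]) simp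
    next
      fix B
      assume "\<forall>i. (\<Sum>j\<in>UNIV. symmetric_part E B $ i $ j *\<^sub>R homogenize (p $ j)) = 0"
        "det (block C (symmetric_part E B)) \<noteq> 0"
      with sym supp show "\<exists>\<Omega>. transpose \<Omega> = \<Omega> \<and> (\<forall>i j. i \<noteq> j \<and> {i, j} \<notin> E \<longrightarrow> \<Omega> $ i $ j = 0) \<and>
          (\<forall>i. (\<Sum>j\<in>UNIV. \<Omega> $ i $ j *\<^sub>R homogenize (p $ j)) = 0) \<and> det (block C \<Omega>) \<noteq> 0"
        by (intro exI[of _ "symmetric_part E B"]) simp
    qed
  qed
  show ?thesis
    unfolding stressable
    by (rule constructible_linear_projection[where a = a, OF a
          real_polynomial_function_position[where P = "\<lambda>i p. homogenize (p $ i)", OF hom] g])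
qed

section \<open>Irreducibility\<close>

lemma finite_zeros_real_polynomial:
  fixes f :: "real \<Rightarrow> real"
  assumes "real_polynomial_function f" "f t0 \<noteq> 0"
  shows "finite {t. f t = 0}"
proof -
  obtain a n where f: "f = (\<lambda>x. \<Sum>i\<le>n. a i * x ^ i)"
    using real_polynomial_function_imp_sum[OF assms(1)] by blast
  have "\<exists>i\<le>n. a i \<noteq> 0"
  proof (rule ccontr)
    assume "\<not> ?thesis"
    then have "f t0 = 0" by (simp add: f)
    with assms(2) show False by simp
  qed
  then show ?thesis unfolding f polyfun_finite_roots .
qed

text \<open>Denominators are cleared along the curve; the exponent \<open>m\<close> grows under sums
  and products.\<close>

lemma rational_pullback:
  fixes f :: "'a::euclidean_space \<Rightarrow> real"
  assumes "real_polynomial_function f"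
    and \<gamma>: "polynomial_function (\<gamma> :: real \<Rightarrow> 'a)" and h: "real_polynomial_function h"
  shows "\<exists>F m. real_polynomial_function F \<and> (\<forall>t. h t \<noteq> 0 \<longrightarrow> F t = h t ^ m * f (\<gamma> t /\<^sub>R h t))"
  using assms(1)
proof induction
  case (linear f)
  have "real_polynomial_function (\<lambda>t. f (\<gamma> t))"
    using real_polynomial_function_compose[OF \<gamma>, of f] linear
    by (simp add: o_def real_polynomial_function.intros(1))
  moreover have "f (\<gamma> t) = h t ^ 1 * f (\<gamma> t /\<^sub>R h t)" if "h t \<noteq> 0" for t
    using linear that by (simp add: bounded_linear.linear linear_cmul)
  ultimately show ?case by blast
next
  case (const c)
  have "c = h t ^ 0 * c" for t by simp
  then show ?case using real_polynomial_function.intros(2)[of c] by blast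
next
  case (add f g)
  then obtain F m G n where F: "real_polynomial_function F" "\<And>t. h t \<noteq> 0 \<Longrightarrow> F t = h t ^ m * f (\<gamma> t /\<^sub>R h t)"
    and G: "real_polynomial_function G" "\<And>t. h t \<noteq> 0 \<Longrightarrow> G t = h t ^ n * g (\<gamma> t /\<^sub>R h t)" by blast
  have "real_polynomial_function (\<lambda>t. h t ^ n * F t + h t ^ m * G t)"
    using F G h by (intro real_polynomial_function.intros(3,4) real_polynomial_function_power)
  moreover have "h t ^ n * F t + h t ^ m * G t = h t ^ (m + n) * (f (\<gamma> t /\<^sub>R h t) + g (\<gamma> t /\<^sub>R h t))"
    if "h t \<noteq> 0" for t
    using F(2)[OF that] G(2)[OF that] by (simp add: power_add algebra_simps)
  ultimately show ?case by blast
next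
  case (mult f g)
  then obtain F m G n where F: "real_polynomial_function F" "\<And>t. h t \<noteq> 0 \<Longrightarrow> F t = h t ^ m * f (\<gamma> t /\<^sub>R h t)"
    and G: "real_polynomial_function G" "\<And>t. h t \<noteq> 0 \<Longrightarrow> G t = h t ^ n * g (\<gamma> t /\<^sub>R h t)" by blast
  have "real_polynomial_function (\<lambda>t. F t * G t)"
    using F G by (intro real_polynomial_function.intros(4))
  moreover have "F t * G t = h t ^ (m + n) * (f (\<gamma> t /\<^sub>R h t) * g (\<gamma> t /\<^sub>R h t))" if "h t \<noteq> 0" for t
    using F(2)[OF that] G(2)[OF that] by (simp add: power_add algebra_simps)
  ultimately show ?case by blast
qed

text \<open>Let \<open>f\<close> be nonzero at \<open>p0\<close> and \<open>g\<close> at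
  \<open>p1\<close>. Their pullbacks to a curve joining the two points are nonzero polynomials in
  \<open>t\<close>, so together with \<open>h\<close> and \<open>\<delta>\<close> they have finitely
  many zeros; yet at every real \<open>t\<close> one of the four vanishes.\<close>

lemma irreducible_if_rationally_connected:
  fixes X :: "'a::euclidean_space set"
  assumes "\<And>p0 p1. p0 \<in> X \<Longrightarrow> p1 \<in> X \<Longrightarrow> \<exists>\<gamma> h \<delta>. polynomial_function \<gamma> \<and>
      real_polynomial_function h \<and> real_polynomial_function \<delta> \<and>
      h 0 \<noteq> 0 \<and> h 1 \<noteq> 0 \<and> \<delta> 0 \<noteq> 0 \<and> \<gamma> 0 /\<^sub>R h 0 = p0 \<and> \<gamma> 1 /\<^sub>R h 1 = p1 \<and>
      (\<forall>t::real. h t \<noteq> 0 \<longrightarrow> \<delta> t \<noteq> 0 \<longrightarrow> \<gamma> t /\<^sub>R h t \<in> X)"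
  shows "irreducible_algebraic_set (zariski_closure X)"
proof (rule irreducible_zariski_closure, rule ccontr)
  fix f g :: "'a \<Rightarrow> real"
  assume f: "real_polynomial_function f" and g: "real_polynomial_function g"
    and fg: "\<forall>x\<in>X. f x * g x = 0" and "\<not> ((\<forall>x\<in>X. f x = 0) \<or> (\<forall>x\<in>X. g x = 0))"
  then obtain p0 p1 where p: "p0 \<in> X" "f p0 \<noteq> 0" "p1 \<in> X" "g p1 \<noteq> 0" by blast
  obtain \<gamma> h \<delta> where \<gamma>: "polynomial_function \<gamma>" and h: "real_polynomial_function h"
    and \<delta>: "real_polynomial_function \<delta>"
    and nz: "h 0 \<noteq> 0" "h 1 \<noteq> 0" "\<delta> 0 \<noteq> 0" and ends: "\<gamma> 0 /\<^sub>R h 0 = p0" "\<gamma> 1 /\<^sub>R h 1 = p1"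
    and X: "\<And>t::real. h t \<noteq> 0 \<Longrightarrow> \<delta> t \<noteq> 0 \<Longrightarrow> \<gamma> t /\<^sub>R h t \<in> X"
    using assms[OF p(1,3)] by blast
  obtain F m where F: "real_polynomial_function F" "\<And>t. h t \<noteq> 0 \<Longrightarrow> F t = h t ^ m * f (\<gamma> t /\<^sub>R h t)"
    using rational_pullback[OF f \<gamma> h] by blast
  obtain G n where G: "real_polynomial_function G" "\<And>t. h t \<noteq> 0 \<Longrightarrow> G t = h t ^ n * g (\<gamma> t /\<^sub>R h t)"
    using rational_pullback[OF g \<gamma> h] by blast
  have "F 0 \<noteq> 0" "G 1 \<noteq> 0" using F(2)[OF nz(1)] G(2)[OF nz(2)] nz ends p by auto
  then have "finite ({t. F t = 0} \<union> {t. G t = 0} \<union> {t. h t = 0} \<union> {t. \<delta> t = 0})"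
    using F(1) G(1) h \<delta> nz finite_zeros_real_polynomial by (metis finite_UnI)
  moreover have "{t. F t = 0} \<union> {t. G t = 0} \<union> {t. h t = 0} \<union> {t. \<delta> t = 0} = UNIV"
  proof -
    have "F t = 0 \<or> G t = 0 \<or> h t = 0 \<or> \<delta> t = 0" for t
    proof (cases "h t = 0 \<or> \<delta> t = 0")
      case False
      then have "f (\<gamma> t /\<^sub>R h t) * g (\<gamma> t /\<^sub>R h t) = 0" using fg X by blast
      then show ?thesis using False F(2)[of t] G(2)[of t] by auto
    qed blast
    then show ?thesis by blast
  qed
  ultimately show False using infinite_UNIV_char_0[where 'a = real] by simp
qed

section \<open>Curves of Gstressable frameworks\<close>

lemma transpose_block: "transpose A = A \<Longrightarrow> transpose (block C A) = block C A"
  by (simp add: vec_eq_iff transpose_def block_def)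

text \<open>The matrix \<open>(h\<^sub>i h\<^sub>j v\<^sub>i \<bullet> J v\<^sub>j)\<close> is a stress matrix for the points \<open>P\<^sub>i / h\<^sub>i\<close>.\<close>

lemma Gstressable_of_block:
  fixes p :: "real^'d::finite^'n::finite" and A :: "real^'n^'n" and v :: "'n \<Rightarrow> real^'n"
  assumes n: "CARD('d option) \<le> CARD('n)" and C: "card C = CARD('d option)"
    and gp: "position_polynomial P \<noteq> 0" and h: "\<And>i. h i \<noteq> 0"
    and hom: "\<And>i. homogenize (p $ i) = P i /\<^sub>R h i"
    and A: "transpose A = A" and det: "det (block C A) \<noteq> 0"
    and v_axis: "\<And>i. i \<notin> C \<Longrightarrow> v i = axis i 1" and v_zero: "\<And>i k. k \<in> C \<Longrightarrow> v i $ k = 0"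
    and v_orth: "\<And>i j. i \<noteq> j \<Longrightarrow> {i, j} \<notin> E \<Longrightarrow> v i \<bullet> (block C A *v v j) = 0"
    and P: "\<And>k. k \<notin> C \<Longrightarrow> P k = - (\<Sum>j\<in>C. v j $ k *\<^sub>R P j)"
  shows "Gstressable E p"
proof -
  let ?J = "block C A"
  define \<Omega> where "\<Omega> = (\<chi> i j. h i * h j * (v i \<bullet> (?J *v v j)))"
  have "position_polynomial (\<lambda>i. inverse (h i) *\<^sub>R P i) \<noteq> 0"
    using gp h by (intro position_polynomial_scale) auto
  then have "position_polynomial (\<lambda>i. homogenize (p $ i)) \<noteq> 0" by (simp add: hom)
  moreover have "transpose \<Omega> = \<Omega>"
  proof -
    have "v j \<bullet> (?J *v v i) = v i \<bullet> (?J *v v j)" for i j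
      by (metis symmetric_inner[OF transpose_block[OF A]] inner_commute)
    then show ?thesis by (simp add: vec_eq_iff transpose_def \<Omega>_def mult_ac)
  qed
  moreover have "\<forall>i j. i \<noteq> j \<and> {i, j} \<notin> E \<longrightarrow> \<Omega> $ i $ j = 0"
    using v_orth by (simp add: \<Omega>_def)
  moreover have "\<forall>i. (\<Sum>j\<in>UNIV. \<Omega> $ i $ j *\<^sub>R homogenize (p $ j)) = 0"
  proof
    fix i
    \<comment> \<open>This says that the coordinates of the \<open>P j\<close> lie in the kernel of
      the matrix with columns \<open>v j\<close>. Row \<open>l\<close> outside \<open>C\<close> is
      the relation for \<open>P l\<close>, and the rows in \<open>C\<close> are zero.\<close>
    have zero: "(\<Sum>j\<in>UNIV. P j $ k *\<^sub>R v j) = 0" for k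
    proof -
      have "(\<Sum>j\<in>UNIV. P j $ k *\<^sub>R v j) $ l = 0" for l
      proof (cases "l \<in> C")
        case True
        then show ?thesis by (simp add: v_zero)
      next
        case False
        have "(\<Sum>j\<in>UNIV. P j $ k *\<^sub>R v j) $ l =
            (\<Sum>j\<in>-C. P j $ k * v j $ l) + (\<Sum>j\<in>C. P j $ k * v j $ l)"
          by (simp add: sum.subset_diff[of C UNIV] Compl_eq_Diff_UNIV)
        also have "(\<Sum>j\<in>-C. P j $ k * v j $ l) = (\<Sum>j\<in>-C. if j = l then P j $ k else 0)"
          by (intro sum.cong) (auto simp: v_axis axis_def)
        also have "\<dots> = P l $ k" using False by simp
        also have "P l $ k + (\<Sum>j\<in>C. P j $ k * v j $ l) = 0"
          by (simp add: P[OF False] mult.commute)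
        finally show ?thesis .
      qed
      then show ?thesis by (simp add: vec_eq_iff)
    qed
    have "(\<Sum>j\<in>UNIV. \<Omega> $ i $ j *\<^sub>R homogenize (p $ j)) $ k = 0" for k
    proof -
      have "(\<Sum>j\<in>UNIV. \<Omega> $ i $ j *\<^sub>R homogenize (p $ j)) $ k =
          (\<Sum>j\<in>UNIV. h i * (P j $ k * (v i \<bullet> (?J *v v j))))"
        using h by (simp add: \<Omega>_def hom field_simps)
      also have "\<dots> = h i * (v i \<bullet> (?J *v (\<Sum>j\<in>UNIV. P j $ k *\<^sub>R v j)))"
        by (simp add: linear_sum[OF matrix_vector_mul_linear] inner_sum_right sum_distrib_left
            matrix_vector_mult_scaleR)
      finally show ?thesis by (simp add: zero)
    qed
    then show "(\<Sum>j\<in>UNIV. \<Omega> $ i $ j *\<^sub>R homogenize (p $ j)) = 0" by (simp add: vec_eq_iff)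
  qed
  moreover have "det (block C \<Omega>) \<noteq> 0"
    unfolding det_nonzero_iff_ker
  proof (intro allI impI)
    fix x assume x: "block C \<Omega> *v x = 0"
    have xC: "x $ i = 0" if "i \<in> C" for i
      using x block_mult[of C \<Omega> x i] that by simp
    \<comment> \<open>Off \<open>C\<close> the matrix is \<open>A\<close> rescaled by
      \<open>h\<close>, so a kernel vector of its block rescales to one of
      \<open>?J\<close>.\<close>
    have entry: "\<Omega> $ i $ j = h i * h j * A $ i $ j" if "i \<notin> C" "j \<notin> C" for i j
      using that by (simp add: \<Omega>_def v_axis matrix_vector_mul_component inner_axis' inner_axis block_def)
    let ?z = "\<chi> j. h j * x $ j"
    have "(?J *v ?z) $ i = 0" for i
    proof (cases "i \<in> C")
      case True
      then show ?thesis by (simp add: block_mult xC)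
    next
      case False
      then have "0 = (\<Sum>j\<in>-C. \<Omega> $ i $ j * x $ j)"
        using x block_mult[of C \<Omega> x i] by simp
      also have "\<dots> = (\<Sum>j\<in>-C. h i * (A $ i $ j * (h j * x $ j)))"
        using False by (intro sum.cong) (auto simp: entry)
      also have "\<dots> = h i * (?J *v ?z) $ i"
        using False by (simp add: block_mult sum_distrib_left)
      finally show ?thesis using h[of i] by simp
    qed
    then have "?J *v ?z = 0" by (simp add: vec_eq_iff)
    with det have "?z = 0" unfolding det_nonzero_iff_ker by blast
    then show "x = 0" using h by (simp add: vec_eq_iff)
  qed
  ultimately show ?thesis unfolding Gstressable_iff_block[OF n C] by blast
qed

text \<open>The vectors outside \<open>C\<close> stay fixed, and \<open>outside\<close> makes them
  orthogonal as required. Those in \<open>C\<close> are inserted one at a time, each by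
  \<open>orthogonal_polynomial_curve\<close> applied to the images under the block of its
  nonneighbours placed so far.\<close>

lemma orthogonal_representation_curve:
  fixes A :: "real \<Rightarrow> real^'n::finite^'n" and v0 v1 :: "'n \<Rightarrow> real^'n"
  assumes A: "polynomial_function A" "\<And>t. transpose (A t) = A t"
    and axis0: "\<And>i. i \<notin> C \<Longrightarrow> v0 i = axis i 1" and axis1: "\<And>i. i \<notin> C \<Longrightarrow> v1 i = axis i 1"
    and zero0: "\<And>i k. k \<in> C \<Longrightarrow> v0 i $ k = 0" and zero1: "\<And>i k. k \<in> C \<Longrightarrow> v1 i $ k = 0"
    and orth0: "\<And>i j. i \<noteq> j \<Longrightarrow> {i, j} \<notin> E \<Longrightarrow> v0 i \<bullet> (block C (A 0) *v v0 j) = 0"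
    and orth1: "\<And>i j. i \<noteq> j \<Longrightarrow> {i, j} \<notin> E \<Longrightarrow> v1 i \<bullet> (block C (A 1) *v v1 j) = 0"
    and outside: "\<And>i j t. i \<notin> C \<Longrightarrow> j \<notin> C \<Longrightarrow> i \<noteq> j \<Longrightarrow> {i, j} \<notin> E \<Longrightarrow> A t $ i $ j = 0"
    and ind0: "\<And>j T \<kappa>. T \<subseteq> {i. i \<noteq> j \<and> {i, j} \<notin> E} \<Longrightarrow>
      (\<Sum>i\<in>T. \<kappa> i *\<^sub>R (block C (A 0) *v v0 i)) = 0 \<Longrightarrow> \<forall>i\<in>T. \<kappa> i = 0"
    and ind1: "\<And>j T \<kappa>. T \<subseteq> {i. i \<noteq> j \<and> {i, j} \<notin> E} \<Longrightarrow>
      (\<Sum>i\<in>T. \<kappa> i *\<^sub>R (block C (A 1) *v v1 i)) = 0 \<Longrightarrow> \<forall>i\<in>T. \<kappa> i = 0"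
  obtains v :: "'n \<Rightarrow> real \<Rightarrow> real^'n" where
    "\<And>i. polynomial_function (v i)" "\<And>i. v i 0 = v0 i" "\<And>i. v i 1 = v1 i"
    "\<And>i t. i \<notin> C \<Longrightarrow> v i t = axis i 1" "\<And>i k t. k \<in> C \<Longrightarrow> v i t $ k = 0"
    "\<And>i j t. i \<noteq> j \<Longrightarrow> {i, j} \<notin> E \<Longrightarrow> v i t \<bullet> (block C (A t) *v v j t) = 0"
proof -
  let ?J = "\<lambda>t. block C (A t)"
  let ?S = "{x :: real^'n. \<forall>k\<in>C. x $ k = 0}"
  have S: "subspace ?S" by (auto simp: subspace_def)
  have J_sym: "x \<bullet> (?J t *v y) = y \<bullet> (?J t *v x)" for x y t
    by (metis symmetric_inner[OF transpose_block[OF A(2)]] inner_commute)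
  have J_poly: "polynomial_function (\<lambda>t. ?J t *v x t)" if "polynomial_function x" for x
  proof (rule polynomial_function_vec)
    fix i
    have "real_polynomial_function (\<lambda>t. A t $ i $ j)" for j
      by (intro real_polynomial_function_vec_nth polynomial_function_vec_nth A)
    moreover have "real_polynomial_function (\<lambda>t. x t $ j)" for j
      by (intro real_polynomial_function_vec_nth that)
    ultimately have "real_polynomial_function (\<lambda>t. (?J t *v x t) $ i)"
      unfolding block_mult
      by (cases "i \<in> C") (auto intro!: real_polynomial_function_sum real_polynomial_function.intros(4))
    then show "polynomial_function (\<lambda>t. (?J t *v x t) $ i)"
      by (simp add: real_polynomial_function_eq)
  qed
  \<comment> \<open>\<open>D\<close> holds the vertices of \<open>C\<close> already placed; the
    others are not yet constrained by orthogonality.\<close>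
  have "\<exists>v. (\<forall>i. polynomial_function (v i)) \<and> (\<forall>i t. i \<notin> C \<longrightarrow> v i t = axis i 1) \<and>
      (\<forall>i t. v i t \<in> ?S) \<and> (\<forall>i\<in>D. v i 0 = v0 i \<and> v i 1 = v1 i) \<and>
      (\<forall>i\<in>-C \<union> D. \<forall>j\<in>-C \<union> D. \<forall>t. i \<noteq> j \<longrightarrow> {i, j} \<notin> E \<longrightarrow> v i t \<bullet> (?J t *v v j t) = 0)"
    if "finite D" "D \<subseteq> C" for D
    using that
  proof induction
    case empty
    have "axis i 1 \<bullet> (?J t *v axis j 1) = (if i \<notin> C \<and> j \<notin> C then A t $ i $ j else if i = j then 1 else 0)" for i j t
      by (simp add: matrix_vector_mul_component inner_axis' inner_axis block_def)
    then show ?case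
      using outside
      \<comment> \<open>Zero is a provisional value for the vertices of \<open>C\<close>, to be
        overwritten later.\<close>
      by (intro exI[of _ "\<lambda>i t. if i \<in> C then 0 else axis i 1"]) (auto simp: axis_def)
  next
    case (insert c D)
    from insert.prems have "D \<subseteq> C" by simp
    from insert.IH[OF this] obtain v where v': "\<forall>i. polynomial_function (v i)" "\<forall>i t. i \<notin> C \<longrightarrow> v i t = axis i 1"
      "\<forall>i t. v i t \<in> ?S" "\<forall>i\<in>D. v i 0 = v0 i \<and> v i 1 = v1 i"
      "\<forall>i\<in>-C \<union> D. \<forall>j\<in>-C \<union> D. \<forall>t. i \<noteq> j \<longrightarrow> {i, j} \<notin> E \<longrightarrow> v i t \<bullet> (?J t *v v j t) = 0"
      by (elim exE conjE) (rule that; assumption)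
    note v = v'[rule_format]
    define T where "T = {i \<in> -C \<union> D. i \<noteq> c \<and> {i, c} \<notin> E}"
    have v01: "v i 0 = v0 i" "v i 1 = v1 i" if "i \<in> T" for i
      using that v(2,4) axis0 axis1 by (auto simp: T_def)
    have T: "T \<subseteq> {i. i \<noteq> c \<and> {i, c} \<notin> E}" by (auto simp: T_def)
    have T': "c \<noteq> i" "{c, i} \<notin> E" if "i \<in> T" for i
      using that by (auto simp: T_def insert_commute)
    obtain x where x: "polynomial_function x" "x 0 = v0 c" "x 1 = v1 c" "\<And>t. x t \<in> ?S"
      "\<And>i t. i \<in> T \<Longrightarrow> x t \<bullet> (?J t *v v i t) = 0"
    proof (rule orthogonal_polynomial_curve[of T "\<lambda>i t. ?J t *v v i t" ?S "v0 c" "v1 c"])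
      show "?J t *v v i t \<in> ?S" for i t
        using v(3)[of i t] by (simp add: block_mult)
      show "\<forall>i\<in>T. \<kappa> i = 0" if "(\<Sum>i\<in>T. \<kappa> i *\<^sub>R (?J 0 *v v i 0)) = 0" for \<kappa>
        using that v01 by (intro ind0[OF T]) simp
      show "\<forall>i\<in>T. \<kappa> i = 0" if "(\<Sum>i\<in>T. \<kappa> i *\<^sub>R (?J 1 *v v i 1)) = 0" for \<kappa>
        using that v01 by (intro ind1[OF T]) simp
    qed (use S zero0 zero1 v(1) v01 T' orth0 orth1 J_poly in auto)
    show ?case
    proof (rule exI[of _ "v(c := x)"], intro conjI allI ballI impI)
      fix i j t
      assume i: "i \<in> - C \<union> insert c D" and j: "j \<in> - C \<union> insert c D" and ij: "i \<noteq> j" "{i, j} \<notin> E"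
      show "(v(c := x)) i t \<bullet> (?J t *v (v(c := x)) j t) = 0"
      proof (cases "i = c")
        case True
        then have "j \<in> T" using j ij by (auto simp: T_def insert_commute)
        with True ij x(5) show ?thesis by simp
      next
        case False
        show ?thesis
        proof (cases "j = c")
          case True
          then have "i \<in> T" using i ij by (auto simp: T_def)
          with True False x(5) J_sym show ?thesis by simp
        next
          case False
          with \<open>i \<noteq> c\<close> i j ij show ?thesis by (simp add: v(5))
        qed
      qed
    qed (use v x insert.prems in auto)
  qed
  from this[OF finite order_refl] obtain v where v': "\<forall>i. polynomial_function (v i)" "\<forall>i t. i \<notin> C \<longrightarrow> v i t = axis i 1"
      "\<forall>i t. v i t \<in> ?S" "\<forall>i\<in>C. v i 0 = v0 i \<and> v i 1 = v1 i"
      "\<forall>i\<in>-C \<union> C. \<forall>j\<in>-C \<union> C. \<forall>t. i \<noteq> j \<longrightarrow> {i, j} \<notin> E \<longrightarrow> v i t \<bullet> (?J t *v v j t) = 0"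
    by (elim exE conjE) (rule that; assumption)
  note v = v'[rule_format]
  have "v i t \<bullet> (?J t *v v j t) = 0" if "i \<noteq> j" "{i, j} \<notin> E" for i j t
    using that by (intro v(5)) auto
  moreover have "v i 0 = v0 i" "v i 1 = v1 i" for i
    using v(2,4) axis0 axis1 by (cases "i \<in> C"; simp)+
  ultimately show ?thesis using v(1-3) by (intro that[of v]) auto
qed

text \<open>Both stress matrices are decomposed with the same \<open>C\<close>, the decompositions
  are joined by a polynomial curve, and the points are recovered from the kernel by clearing the
  homogenizing coordinates.\<close>

lemma Gstressable_rational_curve:
  fixes p0 p1 :: "real^'d::finite^'n::finite"
  assumes n: "CARD('d option) < CARD('n)" and st: "Gstressable E p0" "Gstressable E p1"
  shows "\<exists>\<gamma> h \<delta>. polynomial_function \<gamma> \<and> real_polynomial_function h \<and> real_polynomial_function \<delta> \<and>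
    h 0 \<noteq> 0 \<and> h 1 \<noteq> 0 \<and> \<delta> 0 \<noteq> 0 \<and> \<gamma> 0 /\<^sub>R h 0 = p0 \<and> \<gamma> 1 /\<^sub>R h 1 = p1 \<and>
    (\<forall>t::real. h t \<noteq> 0 \<longrightarrow> \<delta> t \<noteq> 0 \<longrightarrow> \<gamma> t /\<^sub>R h t \<in> {p. Gstressable E p})"
proof -
  let ?P0 = "\<lambda>i. homogenize (p0 $ i)" and ?P1 = "\<lambda>i. homogenize (p1 $ i)"
  have n': "CARD('d option) \<le> CARD('n)" using n by simp
  obtain C :: "'n set" where C: "card C = CARD('d option)"
    using obtain_subset_with_card_n[OF n'] by metis
  obtain \<Omega>0 where \<Omega>0: "dependency ?P0 \<Omega>0" "\<And>i j. i \<noteq> j \<Longrightarrow> {i, j} \<notin> E \<Longrightarrow> \<Omega>0 $ i $ j = 0"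
    "rank \<Omega>0 + CARD('d option) = CARD('n)"
    using st(1) unfolding Gstressable_iff_dependency[OF n'] by blast
  obtain \<Omega>1 where \<Omega>1: "dependency ?P1 \<Omega>1" "\<And>i j. i \<noteq> j \<Longrightarrow> {i, j} \<notin> E \<Longrightarrow> \<Omega>1 $ i $ j = 0"
    "rank \<Omega>1 + CARD('d option) = CARD('n)"
    using st(2) unfolding Gstressable_iff_dependency[OF n'] by blast
  interpret D0: dependency ?P0 \<Omega>0 by (rule \<Omega>0)
  interpret D1: dependency ?P1 \<Omega>1 by (rule \<Omega>1)
  obtain v0 where v0: "\<And>i. i \<notin> C \<Longrightarrow> v0 i = axis i 1" "\<And>i k. k \<in> C \<Longrightarrow> v0 i $ k = 0"
    "\<And>k. k \<notin> C \<Longrightarrow> ?P0 k = - (\<Sum>j\<in>C. v0 j $ k *\<^sub>R ?P0 j)"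
    "\<And>i j. v0 i \<bullet> (block C \<Omega>0 *v v0 j) = \<Omega>0 $ i $ j"
    "\<And>T \<kappa>. card T + CARD('d option) \<le> CARD('n) \<Longrightarrow>
      (\<Sum>i\<in>T. \<kappa> i *\<^sub>R (block C \<Omega>0 *v v0 i)) = 0 \<Longrightarrow> \<forall>i\<in>T. \<kappa> i = 0"
  proof (rule D0.block_decomposition[OF \<Omega>0(3) C], goal_cases)
    case (1 v)
    show ?case by (rule 1(1)) (fact 1)+
  qed
  obtain v1 where v1: "\<And>i. i \<notin> C \<Longrightarrow> v1 i = axis i 1" "\<And>i k. k \<in> C \<Longrightarrow> v1 i $ k = 0"
    "\<And>k. k \<notin> C \<Longrightarrow> ?P1 k = - (\<Sum>j\<in>C. v1 j $ k *\<^sub>R ?P1 j)"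
    "\<And>i j. v1 i \<bullet> (block C \<Omega>1 *v v1 j) = \<Omega>1 $ i $ j"
    "\<And>T \<kappa>. card T + CARD('d option) \<le> CARD('n) \<Longrightarrow>
      (\<Sum>i\<in>T. \<kappa> i *\<^sub>R (block C \<Omega>1 *v v1 i)) = 0 \<Longrightarrow> \<forall>i\<in>T. \<kappa> i = 0"
  proof (rule D1.block_decomposition[OF \<Omega>1(3) C], goal_cases)
    case (1 v)
    show ?case by (rule 1(1)) (fact 1)+
  qed
  \<comment> \<open>The bound speaks of the graph alone, so a single stress matrix provides it for
    both ends.\<close>
  have small: "card T + CARD('d option) \<le> CARD('n)" if "T \<subseteq> {i. i \<noteq> j \<and> {i, j} \<notin> E}" for T j
    using D0.column_zeros_bound[OF \<Omega>0(3) n, of T j] \<Omega>0(2) that by fastforce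
  \<comment> \<open>Symmetry and the zero pattern survive interpolation. The block may become
    singular in between, which \<open>\<delta>\<close> will record.\<close>
  define A where "A t = (1 - t) *\<^sub>R \<Omega>0 + t *\<^sub>R \<Omega>1" for t
  have lin: "polynomial_function (\<lambda>t. (1 - t) *\<^sub>R x + t *\<^sub>R y)" for x y :: "'b::euclidean_space"
    by (intro polynomial_function_add polynomial_function_mult polynomial_function_const
        polynomial_function_diff polynomial_function_id)
  have A_poly: "polynomial_function A" unfolding A_def[abs_def] by (rule lin)
  have A_sym: "transpose (A t) = A t" for t
    using D0.entry_symmetric D1.entry_symmetric by (simp add: A_def transpose_def vec_eq_iff)
  have A_ends: "A 0 = \<Omega>0" "A 1 = \<Omega>1" by (simp_all add: A_def)
  obtain v where v: "\<And>i. polynomial_function (v i)" "\<And>i. v i 0 = v0 i" "\<And>i. v i 1 = v1 i"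
    "\<And>i t. i \<notin> C \<Longrightarrow> v i t = axis i 1" "\<And>i k t. k \<in> C \<Longrightarrow> v i t $ k = 0"
    "\<And>i j t. i \<noteq> j \<Longrightarrow> {i, j} \<notin> E \<Longrightarrow> v i t \<bullet> (block C (A t) *v v j t) = 0"
  proof (rule orthogonal_representation_curve[of A C v0 v1 E])
    show "\<forall>i\<in>T. \<kappa> i = 0" if "T \<subseteq> {i. i \<noteq> j \<and> {i, j} \<notin> E}"
      "(\<Sum>i\<in>T. \<kappa> i *\<^sub>R (block C (A 0) *v v0 i)) = 0" for j T \<kappa>
      using v0(5)[OF small[OF that(1)]] that(2) by (simp add: A_ends)
    show "\<forall>i\<in>T. \<kappa> i = 0" if "T \<subseteq> {i. i \<noteq> j \<and> {i, j} \<notin> E}"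
      "(\<Sum>i\<in>T. \<kappa> i *\<^sub>R (block C (A 1) *v v1 i)) = 0" for j T \<kappa>
      using v1(5)[OF small[OF that(1)]] that(2) by (simp add: A_ends)
    show "A t $ i $ j = 0" if "i \<noteq> j" "{i, j} \<notin> E" for i j t
      using \<Omega>0(2)[OF that] \<Omega>1(2)[OF that] by (simp add: A_def)
    fix v
    assume v: "\<And>i. polynomial_function (v i)" "\<And>i. v i 0 = v0 i" "\<And>i. v i 1 = v1 i"
      "\<And>i t. i \<notin> C \<Longrightarrow> v i t = axis i 1" "\<And>i k t. k \<in> C \<Longrightarrow> v i t $ k = 0"
      "\<And>i j t. i \<noteq> j \<Longrightarrow> {i, j} \<notin> E \<Longrightarrow> v i t \<bullet> (block C (A t) *v v j t) = 0"
    show thesis by (rule that) (fact v)+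
  qed (use A_poly A_sym v0(1,2,4) v1(1,2,4) \<Omega>0(2) \<Omega>1(2) in \<open>simp_all add: A_ends\<close>)
  define Q where "Q j t = (1 - t) *\<^sub>R ?P0 j + t *\<^sub>R ?P1 j" for j and t :: real
  \<comment> \<open>On \<open>C\<close> the homogeneous points move linearly; elsewhere they are
    forced by the kernel relation. The points of \<open>C\<close> need not keep homogenizing
    coordinate 1 as part of a solution off \<open>C\<close>, whence the divisors
    \<open>h\<close>.\<close>
  define P where "P k t = (if k \<in> C then Q k t else - (\<Sum>j\<in>C. v j t $ k *\<^sub>R Q j t))" for k t
  have Q_poly: "polynomial_function (Q j)" for j unfolding Q_def[abs_def] by (rule lin)
  have P_poly: "polynomial_function (P k)" for k
  proof (cases "k \<in> C")
    case True
    then show ?thesis using Q_poly by (simp add: P_def[abs_def])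
  next
    case False
    have "polynomial_function (\<lambda>t. - (\<Sum>j\<in>C. v j t $ k *\<^sub>R Q j t))"
      by (intro polynomial_function_minus polynomial_function_sum polynomial_function_mult
          polynomial_function_vec_nth v(1) Q_poly finite)
    with False show ?thesis by (simp add: P_def[abs_def])
  qed
  have P0: "P k 0 = ?P0 k" and P1: "P k 1 = ?P1 k" for k
    using v0(3)[of k] v1(3)[of k] by (simp_all add: P_def Q_def v(2,3))
  define h where "h i t = P i t $ None" for i t
  define H where "H t = (\<Prod>i\<in>UNIV. h i t)" for t
  \<comment> \<open>The factors of the other vertices bring all points to the common denominator
    \<open>H\<close>.\<close>
  define \<gamma> where "\<gamma> t = (\<chi> i. \<chi> l. (\<Prod>k\<in>UNIV - {i}. h k t) * P i t $ Some l)" for t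
  \<comment> \<open>The zeros are the parameters where the block is singular or general position is
    lost.\<close>
  define \<delta> where "\<delta> t = det (block C (A t)) * position_polynomial (\<lambda>i. P i t)" for t
  have h_poly: "real_polynomial_function (h i)" for i
    unfolding h_def[abs_def] by (rule real_polynomial_function_vec_nth[OF P_poly])
  have "real_polynomial_function (\<lambda>t. (\<Prod>k\<in>UNIV - {i}. h k t) * P i t $ Some l)" for i l
    using h_poly P_poly
    by (intro real_polynomial_function.intros(4) real_polynomial_function_prod real_polynomial_function_vec_nth finite)
  then have \<gamma>_poly: "polynomial_function \<gamma>"
    unfolding \<gamma>_def[abs_def] real_polynomial_function_eq
    by (intro polynomial_function_vec) simp
  have H_poly: "real_polynomial_function H"
    unfolding H_def[abs_def] using h_poly by (intro real_polynomial_function_prod) auto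
  have "real_polynomial_function (\<lambda>t. A t $ i $ j)" for i j
    by (intro real_polynomial_function_vec_nth polynomial_function_vec_nth A_poly)
  then have "real_polynomial_function (\<lambda>t. block C (A t) $ i $ j)" for i j
    unfolding block_def vec_lambda_beta
    by (cases "i \<in> C"; cases "j \<in> C"; cases "i = j") (simp_all add: real_polynomial_function.intros(2))
  then have \<delta>_poly: "real_polynomial_function \<delta>"
    unfolding \<delta>_def[abs_def]
    by (intro real_polynomial_function.intros(4) real_polynomial_function_det
        real_polynomial_function_position P_poly)
  have coord: "(\<gamma> t /\<^sub>R H t) $ i $ l = P i t $ Some l / h i t" if "H t \<noteq> 0" for t i l
  proof -
    define c where "c = (\<Prod>k\<in>UNIV - {i}. h k t)"
    have H: "H t = h i t * c"
      unfolding H_def c_def by (rule prod.remove) auto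
    have "(\<gamma> t /\<^sub>R H t) $ i $ l = inverse (H t) * (c * P i t $ Some l)"
      by (simp add: \<gamma>_def c_def)
    with that show ?thesis by (simp add: H field_simps)
  qed
  have h_ends: "h i 0 = 1" "h i 1 = 1" for i
    by (simp_all add: h_def P0 P1 homogenize_def)
  then have H_ends: "H 0 = 1" "H 1 = 1" by (simp_all add: H_def)
  have "\<gamma> 0 /\<^sub>R H 0 = p0" "\<gamma> 1 /\<^sub>R H 1 = p1"
    using coord[of 0] coord[of 1] H_ends h_ends
    by (simp_all add: vec_eq_iff P0 P1 homogenize_def)
  moreover have "\<delta> 0 \<noteq> 0"
    using D0.rank_iff_det_block[OF C] \<Omega>0(3) dependency_iff[OF n', of ?P0 \<Omega>0] \<Omega>0(1)
    by (simp add: \<delta>_def A_ends P0)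
  moreover have "Gstressable E (\<gamma> t /\<^sub>R H t)" if "H t \<noteq> 0" "\<delta> t \<noteq> 0" for t
  proof (rule Gstressable_of_block[OF n' C, where P = "\<lambda>i. P i t" and h = "\<lambda>i. h i t"
        and A = "A t" and v = "\<lambda>i. v i t"])
    show hne: "h i t \<noteq> 0" for i using that(1) by (auto simp: H_def)
    show "homogenize ((\<gamma> t /\<^sub>R H t) $ i) = P i t /\<^sub>R h i t" for i
    proof -
      have "homogenize ((\<gamma> t /\<^sub>R H t) $ i) $ k = (P i t /\<^sub>R h i t) $ k" for k
        using coord[OF that(1), of i] hne[of i]
        by (cases k) (simp_all add: homogenize_def h_def divide_inverse mult.commute)
      then show ?thesis by (simp add: vec_eq_iff)
    qed
    show "P k t = - (\<Sum>j\<in>C. v j t $ k *\<^sub>R P j t)" if "k \<notin> C" for k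
      using that by (simp add: P_def)
  qed (use that A_sym v in \<open>auto simp: \<delta>_def\<close>)
  ultimately show ?thesis
    using \<gamma>_poly H_poly \<delta>_poly H_ends by (intro exI[of _ \<gamma>] exI[of _ H] exI[of _ \<delta>]) simp
qed

theorem proposition5p3:
  fixes E :: "'n::finite set set"
  assumes "simple_graph E"
    and "CARD('d::finite) \<ge> 1"
    and "CARD('n) \<ge> CARD('d) + 2"
  shows "irreducible_constructible_set {p :: real^'d^'n. Gstressable E p}"
proof -
  \<comment> \<open>Here \<open>CARD('d option)\<close> is d + 1; the strict inequality feeds
    \<open>column_zeros_bound\<close>.\<close>
  have n: "CARD('d option) < CARD('n)" using assms(3) by simp
  have "irreducible_algebraic_set (zariski_closure {p :: real^'d^'n. Gstressable E p})"
    by (rule irreducible_if_rationally_connected, rule Gstressable_rational_curve[OF n]) auto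
  moreover have "constructible {p :: real^'d^'n. Gstressable E p}"
    using n by (intro constructible_Gstressable) simp
  ultimately show ?thesis by (simp add: irreducible_constructible_set_def)
qed

end
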